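(* Let $V$ be a nontrivial finite-dimensional irreducible $\boxtimes$-module over $\mathbb F$. Then the following (i), (ii) are equivalent. (i) $V$ is isomorphic to an evaluation module for $\boxtimes$. (ii) There exist mutually distinct $i,j,k,\ell\in\mathbb I$ such that the actions of $x_{ij},x_{ik},x_{i\ell}$ on $V$ are linearly dependent.
   Context: $\mathbb F$ is an algebraically closed field of characteristic $0$, and $\mathbb I=\{0,1,2,3\}$. The tetrahedron algebra $\boxtimes$ is the Lie algebra over $\mathbb F$ with generators $\{x_{ij}\mid i,j\in\mathbb I,\ i\ne j\}$ and relations: (i) $x_{ij}+x_{ji}=0$ for distinct $i,j$; (ii) $[x_{ij},x_{jk}]=2x_{ij}+2x_{jk}$ for mutually distinct $i,j,k$; (iii) $[x_{ij},[x_{ij},[x_{ij},x_{k\ell}]]]=4[x_{ij},x_{k\ell}]$ for mutually distinct $i,j,k,\ell$. The trivial $\boxtimes$-module is the one-dimensional module on which every element of $\boxtimes$ acts as $0$ (unique up to isomorphism); other irreducible modules are nontrivial. Let $\mathfrak{sl}_2=\mathfrak{sl}_2(\mathbb F)$ with basis $e,f,h$, $[h,e]=2e$, $[h,f]=-2f$, $[e,f]=h$. Put $x=2e-h$, $y=-2f-h$, $z=h$. For $a\in\mathbb F\setminus\{0,1\}$ let $EV_a:\boxtimes\to\mathfrak{sl}_2$ be the (surjective) Lie algebra homomorphism with $x_{12}\mapsto x$, $x_{23}\mapsto y$, $x_{31}\mapsto z$, $x_{03}\mapsto ay+(a-1)z$, $x_{01}\mapsto(1-a^{-1})z-a^{-1}x$,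 $x_{02}\mapsto(1-a)^{-1}x+a(1-a)^{-1}y$. For $d\ge0$ let $V_d$ be the irreducible $\mathfrak{sl}_2$-module of dimension $d+1$. An evaluation module is a $\boxtimes$-module $V_d(a)$, with $d\ge 1$ an integer and $a\in\mathbb F\setminus\{0,1\}$, obtained from $V_d$ by pulling back the action via $EV_a$. *)

theory Defs
  imports
    "HOL-Library.Numeral_Type"
    "HOL-Library.Product_Plus"
    "HOL-Computational_Algebra.Polynomial"
begin

section \<open>Lie algebras and their modules\<close>

locale lie_algebra = vector_space scale
  for scale :: "'f::field \<Rightarrow> 'l::ab_group_add \<Rightarrow> 'l" +
  fixes bracket :: "'l \<Rightarrow> 'l \<Rightarrow> 'l"
  assumes bracket_add_left: "bracket (x + y) z = bracket x z + bracket y z"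
    and bracket_add_right: "bracket x (y + z) = bracket x y + bracket x z"
    and bracket_scale_left: "bracket (scale c x) y = scale c (bracket x y)"
    and bracket_scale_right: "bracket x (scale c y) = scale c (bracket x y)"
    and bracket_self: "bracket x x = 0"
    and jacobi: "bracket x (bracket y z) + bracket y (bracket z x) + bracket z (bracket x y) = 0"

locale lie_hom =
  L1: lie_algebra s1 b1 + L2: lie_algebra s2 b2 + Vector_Spaces.linear s1 s2 \<phi>
  for s1 :: "'f::field \<Rightarrow> 'l::ab_group_add \<Rightarrow> 'l" and b1
    and s2 :: "'f \<Rightarrow> 'm::ab_group_add \<Rightarrow> 'm" and b2
    and \<phi> :: "'l \<Rightarrow> 'm" +
  assumes hom_bracket: "\<phi> (b1 x y) = b2 (\<phi> x) (\<phi> y)"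

text \<open>A module is carried by a subspace \<open>M\<close> of an ambient vector space, so that families of
  modules of varying dimension can live in one type. The action is unconstrained outside \<open>M\<close>.\<close>

locale lie_module = L: lie_algebra sL br + V: vector_space sV
  for sL :: "'f::field \<Rightarrow> 'l::ab_group_add \<Rightarrow> 'l" and br :: "'l \<Rightarrow> 'l \<Rightarrow> 'l"
    and sV :: "'f \<Rightarrow> 'v::ab_group_add \<Rightarrow> 'v" +
  fixes M :: "'v set" and act :: "'l \<Rightarrow> 'v \<Rightarrow> 'v"
  assumes subspace_carrier: "V.subspace M"
    and act_closed: "v \<in> M \<Longrightarrow> act x v \<in> M"
    and act_add_right: "\<lbrakk>v \<in> M; w \<in> M\<rbrakk> \<Longrightarrow> act x (v + w) = act x v + act x w"
    and act_scale_right: "v \<in> M \<Longrightarrow> act x (sV c v) = sV c (act x v)"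
    and act_add_left: "v \<in> M \<Longrightarrow> act (x + y) v = act x v + act y v"
    and act_scale_left: "v \<in> M \<Longrightarrow> act (sL c x) v = sV c (act x v)"
    and act_bracket: "v \<in> M \<Longrightarrow> act (br x y) v = act x (act y v) - act y (act x v)"
begin

definition finite_dim :: bool where
  "finite_dim \<longleftrightarrow> (\<exists>B. finite B \<and> V.span B = M)"

definition submodule :: "'v set \<Rightarrow> bool" where
  "submodule N \<longleftrightarrow> V.subspace N \<and> N \<subseteq> M \<and> (\<forall>x. \<forall>v\<in>N. act x v \<in> N)"

definition irreducible_module :: bool where
  "irreducible_module \<longleftrightarrow> M \<noteq> {0} \<and> (\<forall>N. submodule N \<longrightarrow> N = {0} \<or> N = M)"

definition trivial_module :: bool where
  "trivial_module \<longleftrightarrow> V.dim M = 1 \<and> (\<forall>x. \<forall>v\<in>M. act x v = 0)"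

end

definition module_iso ::
  "('f::field \<Rightarrow> 'v::ab_group_add \<Rightarrow> 'v) \<Rightarrow> 'v set \<Rightarrow> ('l \<Rightarrow> 'v \<Rightarrow> 'v) \<Rightarrow>
   ('f \<Rightarrow> 'w::ab_group_add \<Rightarrow> 'w) \<Rightarrow> 'w set \<Rightarrow> ('l \<Rightarrow> 'w \<Rightarrow> 'w) \<Rightarrow> ('v \<Rightarrow> 'w) \<Rightarrow> bool" where
  "module_iso sV M actV sW N actW \<phi> \<longleftrightarrow>
     bij_betw \<phi> M N \<and>
     (\<forall>v\<in>M. \<forall>w\<in>M. \<phi> (v + w) = \<phi> v + \<phi> w) \<and>
     (\<forall>c. \<forall>v\<in>M. \<phi> (sV c v) = sW c (\<phi> v)) \<and>
     (\<forall>x. \<forall>v\<in>M. \<phi> (actV x v) = actW x (\<phi> v))"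

definition isomorphic_modules ::
  "('f::field \<Rightarrow> 'v::ab_group_add \<Rightarrow> 'v) \<Rightarrow> 'v set \<Rightarrow> ('l \<Rightarrow> 'v \<Rightarrow> 'v) \<Rightarrow>
   ('f \<Rightarrow> 'w::ab_group_add \<Rightarrow> 'w) \<Rightarrow> 'w set \<Rightarrow> ('l \<Rightarrow> 'w \<Rightarrow> 'w) \<Rightarrow> bool" where
  "isomorphic_modules sV M actV sW N actW \<longleftrightarrow> (\<exists>\<phi>. module_iso sV M actV sW N actW \<phi>)"


section \<open>Lie algebras given by generators and relations\<close>

datatype ('g, 'f) lie_term =
    Gen 'g
  | Zero
  | Add "('g, 'f) lie_term" "('g, 'f) lie_term"
  | Smul 'f "('g, 'f) lie_term"
  | Brk "('g, 'f) lie_term" "('g, 'f) lie_term"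

text \<open>The least congruence on terms that contains \<open>R\<close> and the Lie algebra axioms; its quotient is
  the Lie algebra presented by the relations \<open>R\<close>.\<close>

inductive lie_cong ::
  "(('g, 'f::field) lie_term \<Rightarrow> ('g, 'f) lie_term \<Rightarrow> bool) \<Rightarrow>
    ('g, 'f) lie_term \<Rightarrow> ('g, 'f) lie_term \<Rightarrow> bool"
  for R where
  lc_relation: "R s t \<Longrightarrow> lie_cong R s t"
| lc_refl: "lie_cong R t t"
| lc_sym: "lie_cong R s t \<Longrightarrow> lie_cong R t s"
| lc_trans: "lie_cong R s t \<Longrightarrow> lie_cong R t u \<Longrightarrow> lie_cong R s u"
| cong_Add: "lie_cong R s s' \<Longrightarrow> lie_cong R t t' \<Longrightarrow> lie_cong R (Add s t) (Add s' t')"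
| cong_Smul: "lie_cong R t t' \<Longrightarrow> lie_cong R (Smul c t) (Smul c t')"
| cong_Brk: "lie_cong R s s' \<Longrightarrow> lie_cong R t t' \<Longrightarrow> lie_cong R (Brk s t) (Brk s' t')"
| Add_assoc: "lie_cong R (Add (Add s t) u) (Add s (Add t u))"
| Add_commute: "lie_cong R (Add s t) (Add t s)"
| Add_Zero: "lie_cong R (Add Zero t) t"
| Add_neg: "lie_cong R (Add (Smul (-1) t) t) Zero"
| Smul_Add: "lie_cong R (Smul c (Add s t)) (Add (Smul c s) (Smul c t))"
| Smul_plus: "lie_cong R (Smul (c + c') t) (Add (Smul c t) (Smul c' t))"
| Smul_mult: "lie_cong R (Smul (c * c') t) (Smul c (Smul c' t))"
| Smul_one: "lie_cong R (Smul 1 t) t"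
| Brk_Add_left: "lie_cong R (Brk (Add s t) u) (Add (Brk s u) (Brk t u))"
| Brk_Add_right: "lie_cong R (Brk s (Add t u)) (Add (Brk s t) (Brk s u))"
| Brk_Smul_left: "lie_cong R (Brk (Smul c s) t) (Smul c (Brk s t))"
| Brk_Smul_right: "lie_cong R (Brk s (Smul c t)) (Smul c (Brk s t))"
| Brk_self: "lie_cong R (Brk t t) Zero"
| Jacobi: "lie_cong R (Add (Add (Brk s (Brk t u)) (Brk t (Brk u s))) (Brk u (Brk s t))) Zero"

primrec lie_eval ::
  "('f::field \<Rightarrow> 'l::ab_group_add \<Rightarrow> 'l) \<Rightarrow> ('l \<Rightarrow> 'l \<Rightarrow> 'l) \<Rightarrow> ('g \<Rightarrow> 'l) \<Rightarrow>
    ('g, 'f) lie_term \<Rightarrow> 'l" where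
  "lie_eval sc br g (Gen a) = g a"
| "lie_eval sc br g Zero = 0"
| "lie_eval sc br g (Add s t) = lie_eval sc br g s + lie_eval sc br g t"
| "lie_eval sc br g (Smul c t) = sc c (lie_eval sc br g t)"
| "lie_eval sc br g (Brk s t) = br (lie_eval sc br g s) (lie_eval sc br g t)"

lemma (in lie_algebra) lie_eval_cong:
  assumes "lie_cong R s t"
    and R: "\<And>s t. R s t \<Longrightarrow> lie_eval scale bracket g s = lie_eval scale bracket g t"
  shows "lie_eval scale bracket g s = lie_eval scale bracket g t"
  using assms(1)
proof induction
  case (Jacobi s t u)
  show ?case by (simp add: jacobi)
next
  case (Add_neg t)
  show ?case using scale_left_distrib[of "- 1" 1] by simp
qed (simp_all add: R bracket_add_left bracket_add_right bracket_scale_left bracket_scale_right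
      bracket_self scale_right_distrib scale_left_distrib add.assoc add.commute)


section \<open>The tetrahedron algebra\<close>

text \<open>The index set \<open>{0,1,2,3}\<close> is the four-element type \<open>4\<close>. The generators are indexed by the
  ordered pairs of distinct indices only.\<close>

typedef tetra_edge = "{(i::4, j::4). i \<noteq> j}"
  by (rule exI[of _ "(0, 1)"]) simp

abbreviation tetra_gen :: "4 \<Rightarrow> 4 \<Rightarrow> (tetra_edge, 'f) lie_term" where
  "tetra_gen i j \<equiv> Gen (Abs_tetra_edge (i, j))"

inductive tetra_rel :: "(tetra_edge, 'f::field) lie_term \<Rightarrow> (tetra_edge, 'f) lie_term \<Rightarrow> bool" where
  "distinct [i, j] \<Longrightarrow> tetra_rel (Add (tetra_gen i j) (tetra_gen j i)) Zero"
| "distinct [i, j, k] \<Longrightarrow>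
     tetra_rel (Brk (tetra_gen i j) (tetra_gen j k))
       (Add (Smul 2 (tetra_gen i j)) (Smul 2 (tetra_gen j k)))"
| "distinct [i, j, k, l] \<Longrightarrow>
     tetra_rel (Brk (tetra_gen i j) (Brk (tetra_gen i j) (Brk (tetra_gen i j) (tetra_gen k l))))
       (Smul 4 (Brk (tetra_gen i j) (tetra_gen k l)))"

quotient_type (overloaded) 'f tetra = "(tetra_edge, 'f::field) lie_term" / "lie_cong tetra_rel"
  by (rule equivpI)
    (auto intro!: reflpI sympI transpI intro: lie_cong.lc_refl lie_cong.lc_sym lie_cong.lc_trans)

instantiation tetra :: (field) ab_group_add
begin

lift_definition zero_tetra :: "'a tetra" is Zero .

lift_definition plus_tetra :: "'a tetra \<Rightarrow> 'a tetra \<Rightarrow> 'a tetra" is Add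
  by (rule lie_cong.cong_Add)

lift_definition uminus_tetra :: "'a tetra \<Rightarrow> 'a tetra" is "Smul (-1)"
  by (rule lie_cong.cong_Smul)

definition minus_tetra :: "'a tetra \<Rightarrow> 'a tetra \<Rightarrow> 'a tetra" where
  "minus_tetra u v = u + (- v)"

instance
proof
  fix u v w :: "'a tetra"
  show "u + v + w = u + (v + w)" by transfer (rule lie_cong.Add_assoc)
  show "u + v = v + u" by transfer (rule lie_cong.Add_commute)
  show "0 + u = u" by transfer (rule lie_cong.Add_Zero)
  show "- u + u = 0" by transfer (rule lie_cong.Add_neg)
  show "u - v = u + (- v)" by (rule minus_tetra_def)
qed

end

lift_definition tetra_scale :: "'f::field \<Rightarrow> 'f tetra \<Rightarrow> 'f tetra" is Smul
  by (rule lie_cong.cong_Smul)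

lift_definition tetra_bracket :: "'f::field tetra \<Rightarrow> 'f tetra \<Rightarrow> 'f tetra" is Brk
  by (rule lie_cong.cong_Brk)

text \<open>\<open>tetra_x i j\<close> is meaningful for \<open>i \<noteq> j\<close> only.\<close>

lift_definition tetra_x :: "4 \<Rightarrow> 4 \<Rightarrow> 'f::field tetra" is tetra_gen .

lemma lie_algebra_tetra:
  "lie_algebra (tetra_scale :: 'f::field \<Rightarrow> _) tetra_bracket"
proof
  fix u v w :: "'f tetra" and c c' :: 'f
  show "tetra_scale c (u + v) = tetra_scale c u + tetra_scale c v"
    by transfer (rule lie_cong.Smul_Add)
  show "tetra_scale (c + c') u = tetra_scale c u + tetra_scale c' u"
    by transfer (rule lie_cong.Smul_plus)
  show "tetra_scale c (tetra_scale c' u) = tetra_scale (c * c') u"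
    by transfer (rule lie_cong.lc_sym[OF lie_cong.Smul_mult])
  show "tetra_scale 1 u = u"
    by transfer (rule lie_cong.Smul_one)
  show "tetra_bracket (u + v) w = tetra_bracket u w + tetra_bracket v w"
    by transfer (rule lie_cong.Brk_Add_left)
  show "tetra_bracket u (v + w) = tetra_bracket u v + tetra_bracket u w"
    by transfer (rule lie_cong.Brk_Add_right)
  show "tetra_bracket (tetra_scale c u) v = tetra_scale c (tetra_bracket u v)"
    by transfer (rule lie_cong.Brk_Smul_left)
  show "tetra_bracket u (tetra_scale c v) = tetra_scale c (tetra_bracket u v)"
    by transfer (rule lie_cong.Brk_Smul_right)
  show "tetra_bracket u u = 0"
    by transfer (rule lie_cong.Brk_self)
  show "tetra_bracket u (tetra_bracket v w) + tetra_bracket v (tetra_bracket w u)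
      + tetra_bracket w (tetra_bracket u v) = 0"
    by transfer (rule lie_cong.Jacobi)
qed

lemma tetra_relation_1:
  "distinct [i, j] \<Longrightarrow> tetra_x i j + tetra_x j i = 0"
  by transfer (rule lie_cong.lc_relation, rule tetra_rel.intros)

lemma tetra_relation_2:
  "distinct [i, j, k] \<Longrightarrow>
    tetra_bracket (tetra_x i j) (tetra_x j k) = tetra_scale 2 (tetra_x i j) + tetra_scale 2 (tetra_x j k)"
  by transfer (rule lie_cong.lc_relation, rule tetra_rel.intros)

lemma tetra_relation_3:
  "distinct [i, j, k, l] \<Longrightarrow>
    tetra_bracket (tetra_x i j) (tetra_bracket (tetra_x i j) (tetra_bracket (tetra_x i j) (tetra_x k l)))
      = tetra_scale 4 (tetra_bracket (tetra_x i j) (tetra_x k l))"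
  by transfer (rule lie_cong.lc_relation, rule tetra_rel.intros)

lemma tetra_induct [case_names gen zero add scale bracket]:
  fixes u :: "'f::field tetra"
  assumes gen: "\<And>i j. i \<noteq> j \<Longrightarrow> P (tetra_x i j)"
    and zero: "P 0"
    and add: "\<And>u v. P u \<Longrightarrow> P v \<Longrightarrow> P (u + v)"
    and scale: "\<And>c u. P u \<Longrightarrow> P (tetra_scale c u)"
    and bracket: "\<And>u v. P u \<Longrightarrow> P v \<Longrightarrow> P (tetra_bracket u v)"
  shows "P u"
proof -
  have "P (abs_tetra t)" for t :: "(tetra_edge, 'f) lie_term"
  proof (induction t)
    case (Gen e)
    obtain i j where "e = Abs_tetra_edge (i, j)" "i \<noteq> j"
      by (cases e) auto
    then show ?case
      using gen[of i j] by (simp add: tetra_x.abs_eq)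
  next
    case Zero
    then show ?case using zero by (simp add: zero_tetra.abs_eq)
  next
    case (Add s t)
    then show ?case using add by (metis plus_tetra.abs_eq)
  next
    case (Smul c t)
    then show ?case using scale by (metis tetra_scale.abs_eq)
  next
    case (Brk s t)
    then show ?case using bracket by (metis tetra_bracket.abs_eq)
  qed
  then show ?thesis
    using Quotient_abs_rep[OF Quotient_tetra] by metis
qed

text \<open>Homomorphisms out of the tetrahedron algebra: the universal property of the presentation.\<close>

lemma tetra_hom_exists:
  fixes sc :: "'f::field \<Rightarrow> 'l::ab_group_add \<Rightarrow> 'l" and g :: "4 \<Rightarrow> 4 \<Rightarrow> 'l"
  assumes L: "lie_algebra sc br"
    and r1: "\<And>i j. distinct [i, j] \<Longrightarrow> g i j + g j i = 0"
    and r2: "\<And>i j k. distinct [i, j, k] \<Longrightarrow> br (g i j) (g j k) = sc 2 (g i j) + sc 2 (g j k)"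
    and r3: "\<And>i j k l. distinct [i, j, k, l] \<Longrightarrow>
      br (g i j) (br (g i j) (br (g i j) (g k l))) = sc 4 (br (g i j) (g k l))"
  shows "\<exists>\<phi>. lie_hom tetra_scale tetra_bracket sc br \<phi> \<and> (\<forall>i j. i \<noteq> j \<longrightarrow> \<phi> (tetra_x i j) = g i j)"
proof -
  interpret L: lie_algebra sc br by fact
  define G where "G e = (case Rep_tetra_edge e of (i, j) \<Rightarrow> g i j)" for e
  have G: "G (Abs_tetra_edge (i, j)) = g i j" if "i \<noteq> j" for i j
    using that by (simp add: G_def Abs_tetra_edge_inverse)
  have rel: "lie_eval sc br G s = lie_eval sc br G t" if "tetra_rel s t" for s t
    using that
  proof cases
    case (1 i j)
    then show ?thesis using r1[of i j] by (simp add: G)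
  next
    case (2 i j k)
    then show ?thesis using r2[of i j k] by (simp add: G)
  next
    case (3 i j k l)
    then show ?thesis using r3[of i j k l] by (simp add: G)
  qed
  define \<phi> where "\<phi> u = lie_eval sc br G (rep_tetra u)" for u
  have \<phi>: "\<phi> (abs_tetra t) = lie_eval sc br G t" for t
    unfolding \<phi>_def
    by (rule L.lie_eval_cong[OF rep_abs_rsp_left[OF Quotient3_tetra lie_cong.lc_refl] rel])
  have ex: "\<exists>t. u = abs_tetra t" for u :: "'f tetra"
    using Quotient_abs_rep[OF Quotient_tetra] by metis
  have "lie_hom tetra_scale tetra_bracket sc br \<phi>"
  proof (intro lie_hom.intro lie_algebra_tetra L Vector_Spaces.linear.intro module_hom.intro
      lie_hom_axioms.intro module_hom_axioms.intro)
    show "vector_space (tetra_scale :: 'f \<Rightarrow> _)" "vector_space sc"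
      using lie_algebra.axioms(1)[OF lie_algebra_tetra] lie_algebra.axioms(1)[OF L] by blast+
    then show "module (tetra_scale :: 'f \<Rightarrow> _)" "module sc"
      by (simp_all add: module_iff_vector_space)
    fix u v :: "'f tetra" and c :: 'f
    obtain s t where [simp]: "u = abs_tetra s" "v = abs_tetra t"
      using ex by metis
    show "\<phi> (u + v) = \<phi> u + \<phi> v"
      by (simp add: \<phi> plus_tetra.abs_eq)
    show "\<phi> (tetra_scale c u) = sc c (\<phi> u)"
      by (simp add: \<phi> tetra_scale.abs_eq)
    show "\<phi> (tetra_bracket u v) = br (\<phi> u) (\<phi> v)"
      by (simp add: \<phi> tetra_bracket.abs_eq)
  qed
  moreover have "\<phi> (tetra_x i j) = g i j" if "i \<noteq> j" for i j
    using that by (simp add: tetra_x.abs_eq \<phi> G)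
  ultimately show ?thesis by blast
qed


section \<open>The Lie algebra sl2\<close>

text \<open>The triple \<open>(p, q, r)\<close> stands for \<open>p e + q f + r h\<close>.\<close>

type_synonym 'f sl2 = "'f \<times> 'f \<times> 'f"

fun sl2_scale :: "'f::field \<Rightarrow> 'f sl2 \<Rightarrow> 'f sl2" where
  "sl2_scale c (p, q, r) = (c * p, c * q, c * r)"

fun sl2_bracket :: "'f::field sl2 \<Rightarrow> 'f sl2 \<Rightarrow> 'f sl2" where
  "sl2_bracket (p, q, r) (p', q', r') =
     (2 * (r * p' - p * r'), - 2 * (r * q' - q * r'), p * q' - q * p')"

definition sl2_e :: "'f::field sl2" where "sl2_e = (1, 0, 0)"
definition sl2_f :: "'f::field sl2" where "sl2_f = (0, 1, 0)"
definition sl2_h :: "'f::field sl2" where "sl2_h = (0, 0, 1)"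

lemma sl2_brackets:
  "sl2_bracket sl2_h sl2_e = sl2_scale 2 sl2_e"
  "sl2_bracket sl2_h sl2_f = sl2_scale (- 2) sl2_f"
  "sl2_bracket sl2_e sl2_f = sl2_h"
  by (simp_all add: sl2_e_def sl2_f_def sl2_h_def)

lemma lie_algebra_sl2: "lie_algebra (sl2_scale :: 'f::field \<Rightarrow> _) sl2_bracket"
  by unfold_locales (auto simp: zero_prod_def algebra_simps)

definition sl2_x :: "'f::field sl2" where "sl2_x = sl2_scale 2 sl2_e - sl2_h"
definition sl2_y :: "'f::field sl2" where "sl2_y = sl2_scale (- 2) sl2_f - sl2_h"
definition sl2_z :: "'f::field sl2" where "sl2_z = sl2_h"


section \<open>The homomorphisms EV\<close>

definition is_EV :: "'f::field \<Rightarrow> ('f tetra \<Rightarrow> 'f sl2) \<Rightarrow> bool" where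
  "is_EV a \<phi> \<longleftrightarrow>
     lie_hom tetra_scale tetra_bracket sl2_scale sl2_bracket \<phi> \<and>
     \<phi> (tetra_x 1 2) = sl2_x \<and>
     \<phi> (tetra_x 2 3) = sl2_y \<and>
     \<phi> (tetra_x 3 1) = sl2_z \<and>
     \<phi> (tetra_x 0 3) = sl2_scale a sl2_y + sl2_scale (a - 1) sl2_z \<and>
     \<phi> (tetra_x 0 1) = sl2_scale (1 - inverse a) sl2_z - sl2_scale (inverse a) sl2_x \<and>
     \<phi> (tetra_x 0 2) = sl2_scale (inverse (1 - a)) sl2_x + sl2_scale (a * inverse (1 - a)) sl2_y"

definition EV :: "'f::field \<Rightarrow> 'f tetra \<Rightarrow> 'f sl2" where
  "EV a = (THE \<phi>. is_EV a \<phi>)"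

lemma sl2_basis_simps:
  "sl2_x = (2, 0, - 1 :: 'f::field)" "sl2_y = (0, - 2, - 1 :: 'f)" "sl2_z = (0, 0, 1 :: 'f)"
  by (simp_all add: sl2_x_def sl2_y_def sl2_z_def sl2_e_def sl2_f_def sl2_h_def)

lemma tetra_index_cases: "(i::4) = 0 \<or> i = 1 \<or> i = 2 \<or> i = 3"
proof (cases i)
  case (of_int z)
  then have "z \<in> {0, 1, 2, 3}" by auto
  then show ?thesis using of_int by auto
qed

lemma is_EV_unique:
  assumes "is_EV a \<phi>" "is_EV a \<psi>"
  shows "\<phi> = \<psi>"
proof
  fix u :: "'a tetra"
  interpret P: lie_hom tetra_scale tetra_bracket sl2_scale sl2_bracket \<phi>
    using assms(1) by (simp add: is_EV_def)
  interpret Q: lie_hom tetra_scale tetra_bracket sl2_scale sl2_bracket \<psi>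
    using assms(2) by (simp add: is_EV_def)
  have swap: "\<phi> (tetra_x i j) = \<psi> (tetra_x i j)"
    if "\<phi> (tetra_x j i) = \<psi> (tetra_x j i)" "i \<noteq> j" for i j
  proof -
    have "tetra_x i j = - tetra_x j i"
      using tetra_relation_1[of i j] that(2) by (simp add: eq_neg_iff_add_eq_0)
    then show ?thesis using that(1) by (metis P.neg Q.neg)
  qed
  show "\<phi> u = \<psi> u"
  proof (induction u rule: tetra_induct)
    case (gen i j)
    have *: "\<phi> (tetra_x 1 2) = \<psi> (tetra_x 1 2)" "\<phi> (tetra_x 2 3) = \<psi> (tetra_x 2 3)"
      "\<phi> (tetra_x 3 1) = \<psi> (tetra_x 3 1)" "\<phi> (tetra_x 0 3) = \<psi> (tetra_x 0 3)"
      "\<phi> (tetra_x 0 1) = \<psi> (tetra_x 0 1)" "\<phi> (tetra_x 0 2) = \<psi> (tetra_x 0 2)"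
      using assms by (simp_all add: is_EV_def)
    then show ?case
      using tetra_index_cases[of i] tetra_index_cases[of j] gen swap[OF _ gen]
      by (elim disjE) simp_all
  next
    case (bracket u v)
    then show ?case by (simp add: P.hom_bracket Q.hom_bracket)
  qed (simp_all add: P.add Q.add P.scale Q.scale)
qed

lemma is_EV_exists:
  fixes a :: "'f::field"
  assumes a: "a \<noteq> 0" "a \<noteq> 1"
  shows "\<exists>\<phi>. is_EV a \<phi>"
proof -
  define u where "u i j =
    (if (i, j) = (1, 2) then sl2_x else if (i, j) = (2, 3) then sl2_y
     else if (i, j) = (3, 1) then sl2_z
     else if (i, j) = (0, 3) then sl2_scale a sl2_y + sl2_scale (a - 1) sl2_z
     else if (i, j) = (0, 1) then sl2_scale (1 - inverse a) sl2_z - sl2_scale (inverse a) sl2_x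
     else if (i, j) = (0, 2) then
       sl2_scale (inverse (1 - a)) sl2_x + sl2_scale (a * inverse (1 - a)) sl2_y
     else 0)" for i j :: 4
  define g where "g i j = u i j - u j i" for i j
  define b where "b = inverse a"
  define c where "c = inverse (1 - a)"
  have ab: "a * b = 1" and ac: "a * c = c - 1" and bc: "b * c = b + c"
    using a by (simp_all add: b_def c_def field_simps)
  have ab': "a * (b * t) = t" and ac': "a * (c * t) = c * t - t" and bc': "b * (c * t) = b * t + c * t"
    for t
    by (simp_all add: ab ac bc left_diff_distrib distrib_right flip: mult.assoc)
  note rules = algebra_simps ab ac bc ab' ac' bc'
  have g: "g 0 1 = (- 2 * b, 0, 1)" "g 1 0 = (2 * b, 0, - 1)"
    "g 0 2 = (2 * c, 2 - 2 * c, 1 - 2 * c)" "g 2 0 = (- 2 * c, 2 * c - 2, 2 * c - 1)"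
    "g 0 3 = (0, - 2 * a, - 1)" "g 3 0 = (0, 2 * a, 1)"
    "g 1 2 = (2, 0, - 1)" "g 2 1 = (- 2, 0, 1)"
    "g 2 3 = (0, - 2, - 1)" "g 3 2 = (0, 2, 1)"
    "g 3 1 = (0, 0, 1)" "g 1 3 = (0, 0, - 1)"
    by (simp_all add: g_def u_def sl2_basis_simps zero_prod_def rules flip: b_def c_def)
  have r1: "g i j + g j i = 0" for i j
    by (simp add: g_def)
  have r2: "sl2_bracket (g i j) (g j k) = sl2_scale 2 (g i j) + sl2_scale 2 (g j k)"
    if "distinct [i, j, k]" for i j k
    using tetra_index_cases[of i] tetra_index_cases[of j] tetra_index_cases[of k] that
    by (elim disjE) (simp_all add: g rules)
  have ad_cube: "sl2_bracket u (sl2_bracket u (sl2_bracket u v))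
      = sl2_scale (4 * (snd (snd u) * snd (snd u) + fst u * fst (snd u))) (sl2_bracket u v)"
    for u v :: "'f sl2"
    by (cases u; cases v) (simp add: algebra_simps)
  have det: "snd (snd (g i j)) * snd (snd (g i j)) + fst (g i j) * fst (snd (g i j)) = 1"
    if "i \<noteq> j" for i j
    using tetra_index_cases[of i] tetra_index_cases[of j] that
    by (elim disjE) (simp_all add: g rules)
  have r3: "sl2_bracket (g i j) (sl2_bracket (g i j) (sl2_bracket (g i j) (g k l)))
      = sl2_scale 4 (sl2_bracket (g i j) (g k l))"
    if "distinct [i, j, k, l]" for i j k l
    using that det[of i j] by (simp add: ad_cube)
  obtain \<phi> where \<phi>: "lie_hom tetra_scale tetra_bracket sl2_scale sl2_bracket \<phi>"
    and \<phi>_x: "\<And>i j. i \<noteq> j \<Longrightarrow> \<phi> (tetra_x i j) = g i j"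
    using tetra_hom_exists[where g = g, OF lie_algebra_sl2 r1 r2 r3] by blast
  have "is_EV a \<phi>"
    unfolding is_EV_def using \<phi> by (simp add: \<phi>_x g_def u_def)
  then show ?thesis by blast
qed

lemma is_EV_EV:
  assumes "a \<noteq> 0" "a \<noteq> 1"
  shows "is_EV a (EV a)"
  unfolding EV_def using is_EV_exists[OF assms] is_EV_unique by (metis theI)


section \<open>The irreducible sl2-modules and the evaluation modules\<close>

text \<open>The module of dimension \<open>d + 1\<close> is realised as the binary forms of degree \<open>d\<close>, dehomogenised
  to polynomials of degree at most \<open>d\<close>. On the monomials \<open>v\<^sub>i = x ^ i\<close> this is
  \<open>e v\<^sub>i = i v\<^sub>i\<^sub>-\<^sub>1\<close>, \<open>f v\<^sub>i = (d - i) v\<^sub>i\<^sub>+\<^sub>1\<close>, \<open>h v\<^sub>i = (d - 2 i) v\<^sub>i\<close>.\<close>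

definition Vd :: "nat \<Rightarrow> 'f::field poly set" where
  "Vd d = {p. degree p \<le> d}"

fun sl2_act :: "nat \<Rightarrow> 'f::field sl2 \<Rightarrow> 'f poly \<Rightarrow> 'f poly" where
  "sl2_act d (p, q, r) v =
     smult p (pderiv v) +
     smult q (monom (of_nat d) 1 * v - monom 1 2 * pderiv v) +
     smult r (smult (of_nat d) v - monom 2 1 * pderiv v)"

lemma vector_space_smult: "vector_space (smult :: 'f::field \<Rightarrow> _)"
  by unfold_locales (simp_all add: smult_add_right smult_add_left)

lemma sl2_act_monom:
  fixes d i :: nat
  shows "sl2_act d sl2_e (monom (1::'f::field) i) = smult (of_nat i) (monom 1 (i - 1))"
    and "sl2_act d sl2_f (monom (1::'f) i) = smult (of_nat d - of_nat i) (monom 1 (i + 1))"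
    and "sl2_act d sl2_h (monom (1::'f) i) = smult (of_nat d - 2 * of_nat i) (monom 1 i)"
proof -
  show "sl2_act d sl2_e (monom (1::'f) i) = smult (of_nat i) (monom 1 (i - 1))"
    by (simp add: sl2_e_def pderiv_monom smult_monom)
  show "sl2_act d sl2_f (monom (1::'f) i) = smult (of_nat d - of_nat i) (monom 1 (i + 1))"
    by (cases i) (simp_all add: sl2_f_def pderiv_monom mult_monom smult_monom diff_monom)
  show "sl2_act d sl2_h (monom (1::'f) i) = smult (of_nat d - 2 * of_nat i) (monom 1 i)"
    by (cases i) (simp_all add: sl2_h_def pderiv_monom mult_monom smult_monom diff_monom)
qed

lemma Vd_eq_span: "Vd d = module.span smult (monom (1::'f::field) ` {..d})"
proof -
  interpret vector_space "smult :: 'f \<Rightarrow> _" by (rule vector_space_smult)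
  have "p \<in> span (monom 1 ` {..d})" if "degree p \<le> d" for p :: "'f poly"
  proof -
    have "p = (\<Sum>i\<le>d. smult (coeff p i) (monom 1 i))"
      using poly_as_sum_of_monoms'[OF that] by (simp add: smult_monom)
    also have "\<dots> \<in> span (monom 1 ` {..d})"
      by (intro span_sum span_scale span_base) auto
    finally show ?thesis .
  qed
  moreover have "span (monom (1::'f) ` {..d}) \<subseteq> Vd d"
    by (rule span_minimal)
      (auto simp: Vd_def subspace_def degree_monom_eq intro: degree_add_le order.trans[OF degree_smult_le])
  ultimately show ?thesis by (auto simp: Vd_def)
qed

lemma dim_Vd: "vector_space.dim (smult :: 'f::field \<Rightarrow> _) (Vd d) = d + 1"
proof -
  interpret vector_space "smult :: 'f \<Rightarrow> _" by (rule vector_space_smult)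
  have inj: "inj_on (monom (1::'f)) {..d}"
    by (auto simp: inj_on_def monom_eq_iff')
  have "independent (monom (1::'f) ` {..d})"
  proof (rule independent_if_scalars_zero)
    fix f :: "'f poly \<Rightarrow> 'f" and m :: "'f poly"
    assume sum: "(\<Sum>m\<in>monom 1 ` {..d}. smult (f m) m) = 0" and "m \<in> monom 1 ` {..d}"
    then obtain i where i: "m = monom 1 i" "i \<le> d" by auto
    have "(\<Sum>j\<le>d. monom (f (monom 1 j)) j) = (\<Sum>m\<in>monom 1 ` {..d}. smult (f m) m)"
      by (rule sum.reindex_cong[OF inj refl, symmetric]) (simp add: smult_monom)
    then have "(\<Sum>j\<le>d. monom (f (monom 1 j)) j) = 0"
      using sum by simp
    then have "(\<Sum>j\<le>d. coeff (monom (f (monom 1 j)) j) i) = 0"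
      by (metis coeff_0 coeff_sum)
    then show "f m = 0" using i by simp
  qed simp
  then have "dim (monom (1::'f) ` {..d}) = card (monom (1::'f) ` {..d})"
    by (rule dim_eq_card_independent)
  then show ?thesis
    using card_image[OF inj] by (simp add: Vd_eq_span)
qed

lemma lie_module_Vd:
  "lie_module sl2_scale sl2_bracket (smult :: 'f::field \<Rightarrow> _) (Vd d) (sl2_act d)"
proof -
  interpret L: lie_algebra "sl2_scale :: 'f \<Rightarrow> _" sl2_bracket by (rule lie_algebra_sl2)
  interpret vector_space "smult :: 'f \<Rightarrow> _" by (rule vector_space_smult)
  have add: "sl2_act d x (v + w) = sl2_act d x v + sl2_act d x w"
    and scale: "sl2_act d x (smult c v) = smult c (sl2_act d x v)"
    for x c and v w :: "'f poly"
    by (cases x; simp add: pderiv_add pderiv_smult algebra_simps smult_add_right smult_diff_right)+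
  have br: "sl2_act d (sl2_bracket x y) v = sl2_act d x (sl2_act d y v) - sl2_act d y (sl2_act d x v)"
    for x y and v :: "'f poly"
  proof -
    obtain p q r p' q' r' where xy: "x = (p, q, r)" "y = (p', q', r')"
      by (cases x; cases y) auto
    define X where "X = monom (1::'f) 1"
    have sm: "smult c w = [:c:] * w" for c and w :: "'f poly" by simp
    have act: "sl2_act d (p, q, r) v = [:p:] * pderiv v + [:q:] * (of_nat d * X * v - X * X * pderiv v)
      + [:r:] * (of_nat d * v - 2 * X * pderiv v)" for p q r v
      by (simp add: X_def monom_altdef of_nat_poly numeral_poly power2_eq_square)
    have D: "pderiv X = 1" "\<And>c::'f. pderiv [:c:] = 0" "pderiv (of_nat n :: 'f poly) = 0"
      "pderiv (2 :: 'f poly) = 0" for n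
      by (simp_all add: X_def pderiv_monom pderiv_pCons of_nat_poly numeral_poly)
    have C: "[:2 * (r * p' - p * r'):] = 2 * ([:r:] * [:p':] - [:p:] * [:r':])"
      "[:- 2 * (r * q' - q * r'):] = - 2 * ([:r:] * [:q':] - [:q:] * [:r':])"
      "[:p * q' - q * p':] = [:p:] * [:q':] - [:q:] * [:p':]"
      by (simp_all add: numeral_poly algebra_simps)
    show ?thesis
      unfolding xy sl2_bracket.simps act C
      by (simp only: pderiv_add pderiv_diff pderiv_mult D) algebra
  qed
  show ?thesis
  proof
    show "subspace (Vd d)"
      by (simp add: Vd_eq_span)
    fix x y :: "'f sl2" and v w :: "'f poly" and c
    show "sl2_act d x (v + w) = sl2_act d x v + sl2_act d x w"
      by (rule add)
    show "sl2_act d x (smult c v) = smult c (sl2_act d x v)"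
      by (rule scale)
    show "sl2_act d (sl2_bracket x y) v = sl2_act d x (sl2_act d y v) - sl2_act d y (sl2_act d x v)"
      by (rule br)
    show "sl2_act d (x + y) v = sl2_act d x v + sl2_act d y v"
      by (cases x; cases y) (simp add: smult_add_left algebra_simps)
    show "sl2_act d (sl2_scale c x) v = smult c (sl2_act d x v)"
      by (cases x) (simp add: smult_add_right)
    assume "v \<in> Vd d"
    then show "sl2_act d x v \<in> Vd d"
      unfolding Vd_eq_span
    proof (induction rule: span_induct_alt)
      case base
      then show ?case by (cases x) (simp add: span_zero)
    next
      case (step c v w)
      then obtain i where i: "i \<le> d" "v = monom 1 i" by auto
      obtain p q r where "x = (p, q, r)" by (cases x)
      then have x: "sl2_act d x v = smult p (sl2_act d sl2_e v) + smult q (sl2_act d sl2_f v)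
          + smult r (sl2_act d sl2_h v)" for v
        by (simp add: sl2_e_def sl2_f_def sl2_h_def)
      have "smult (of_nat d - of_nat i) (monom 1 (i + 1)) \<in> span (monom (1::'f) ` {..d})"
      proof (cases "i = d")
        case False
        then show ?thesis
          using i(1) by (intro span_scale span_base) auto
      qed (simp add: span_zero)
      moreover have "smult (of_nat i) (monom 1 (i - 1)) \<in> span (monom (1::'f) ` {..d})"
        "smult (of_nat d - 2 * of_nat i) (monom 1 i) \<in> span (monom (1::'f) ` {..d})"
        by (rule span_scale, rule span_base, use i(1) in simp)+
      ultimately have "sl2_act d x v \<in> span (monom 1 ` {..d})"
        unfolding x i(2) sl2_act_monom
        by (intro span_add) (erule span_scale)+
      then show ?case
        using step unfolding add scale by (intro span_add span_scale)
    qed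
  qed
qed

lemma irreducible_Vd:
  "lie_module.irreducible_module (smult :: 'f::field_char_0 \<Rightarrow> _) (Vd d) (sl2_act d)"
proof -
  interpret V: lie_module sl2_scale sl2_bracket "smult :: 'f \<Rightarrow> _" "Vd d" "sl2_act d"
    by (rule lie_module_Vd)
  have one: "1 \<in> N" if N: "V.submodule N" and "p \<in> N" "p \<noteq> 0" for N p
    using that(2,3)
  proof (induction "degree p" arbitrary: p)
    case 0
    obtain c where c: "p = [:c:]" using 0(1) degree_eq_zeroE[of p] by metis
    then have "c \<noteq> 0" using 0(3) by auto
    have "V.V.subspace N" using N by (simp add: V.submodule_def)
    then have "smult (inverse c) p \<in> N" using 0(2) by (rule V.V.subspace_scale)
    then show ?case using c \<open>c \<noteq> 0\<close> by (simp add: one_pCons)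
  next
    case (Suc n)
    have "pderiv p \<in> N"
    proof -
      have "sl2_act d (1, 0, 0) p \<in> N"
        using N Suc.prems(1) by (simp only: V.submodule_def)
      then show ?thesis by simp
    qed
    then show ?case
      using Suc by (intro Suc.hyps(1)[of "pderiv p"]) (auto simp: degree_pderiv pderiv_eq_0_iff)
  qed
  have monoms: "monom 1 i \<in> N" if N: "V.submodule N" and "1 \<in> N" "i \<le> d" for N i
    using that(3)
  proof (induction i)
    case 0
    then show ?case using that by simp
  next
    case (Suc i)
    then have "monom 1 i \<in> N" by simp
    then have "sl2_act d sl2_f (monom 1 i) \<in> N"
      using N unfolding V.submodule_def by (elim conjE) (erule allE, erule bspec)
    then have "smult (of_nat d - of_nat i) (monom 1 (Suc i)) \<in> N"
      by (simp add: sl2_act_monom del: sl2_act.simps)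
    moreover have "V.V.subspace N" using N by (simp add: V.submodule_def)
    ultimately have "smult (inverse (of_nat d - of_nat i)) (smult (of_nat d - of_nat i) (monom 1 (Suc i))) \<in> N"
      by (rule V.V.subspace_scale[rotated])
    then show ?case using Suc.prems by simp
  qed
  show ?thesis
    unfolding V.irreducible_module_def
  proof (intro conjI allI impI)
    show "Vd d \<noteq> {0 :: 'f poly}"
    proof -
      have "(1 :: 'f poly) \<in> Vd d" by (simp add: Vd_def)
      then show ?thesis by (metis singletonD one_neq_zero)
    qed
    fix N assume N: "V.submodule N"
    show "N = {0} \<or> N = Vd d"
    proof (cases "N = {0}")
      case False
      moreover have "0 \<in> N" using N by (simp add: V.submodule_def V.V.subspace_0)
      ultimately obtain p where "p \<in> N" "p \<noteq> 0" by auto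
      then have "monom 1 ` {..d} \<subseteq> N"
        using monoms[OF N one[OF N]] by (intro image_subsetI) simp
      moreover have "V.V.subspace N" "N \<subseteq> Vd d" using N by (simp_all only: V.submodule_def)
      ultimately have "N = Vd d"
        using V.V.span_minimal unfolding Vd_eq_span by (intro equalityI)
      then show ?thesis ..
    qed simp
  qed
qed

definition EV_act :: "nat \<Rightarrow> 'f::field \<Rightarrow> 'f tetra \<Rightarrow> 'f poly \<Rightarrow> 'f poly" where
  "EV_act d a u v = sl2_act d (EV a u) v"

lemma lie_module_EV_act:
  fixes a :: "'f::field"
  assumes "a \<noteq> 0" "a \<noteq> 1"
  shows "lie_module tetra_scale tetra_bracket smult (Vd d) (EV_act d a)"
proof -
  interpret E: lie_hom tetra_scale tetra_bracket sl2_scale sl2_bracket "EV a"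
    using is_EV_EV[OF assms] by (simp add: is_EV_def)
  interpret V: lie_module sl2_scale sl2_bracket smult "Vd d" "sl2_act d"
    by (rule lie_module_Vd)
  show ?thesis
    by unfold_locales
      (simp_all add: EV_act_def V.subspace_carrier V.act_closed V.act_add_right V.act_scale_right
        V.act_add_left V.act_scale_left V.act_bracket E.add E.scale E.hom_bracket)
qed

end

theory Submission
  imports Defs "HOL-Library.Function_Algebras"
begin

text \<open>Bracketing a linear relation between \<open>x\<^sub>i\<^sub>j, x\<^sub>i\<^sub>k, x\<^sub>i\<^sub>l\<close> with \<open>x\<^sub>i\<^sub>j\<close> shows that its
  coefficients sum to \<open>0\<close> and that none of them vanishes, so
  \<open>x\<^sub>i\<^sub>l = p x\<^sub>i\<^sub>j + q x\<^sub>i\<^sub>k\<close> with \<open>p + q = 1\<close>. Then \<open>q x\<^sub>j\<^sub>l - p x\<^sub>i\<^sub>j - x\<^sub>j\<^sub>k\<close> is a highest weight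
  vector of weight \<open>-2\<close> in the finite-dimensional sl2-module \<open>End V\<close>, where sl2 is spanned by
  \<open>x\<^sub>i\<^sub>k, x\<^sub>k\<^sub>j, x\<^sub>j\<^sub>i\<close>; hence it is \<open>0\<close>. This is in turn a linear relation at the vertex \<open>j\<close>, so one
  may assume \<open>i = 0\<close>. The resulting relations are exactly those of \<open>EV\<^sub>a\<close> with \<open>a = p\<close>: the action on
  \<open>V\<close> factors through \<open>EV\<^sub>a\<close>, and \<open>V\<close> is irreducible over sl2.\<close>

section \<open>Endomorphisms of finite-dimensional spaces\<close>

text \<open>If every term avoided the span of its predecessors, the first \<open>n\<close> terms
  would be independent for each \<open>n\<close>, against the bound \<open>card B\<close>.\<close>

lemma (in vector_space) sequence_meets_span:
  assumes "finite B" "\<And>n. w n \<in> span B"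
  shows "\<exists>n::nat. w n \<in> span (w ` {..<n})"
proof (rule ccontr)
  assume "\<not> ?thesis"
  then have *: "w n \<notin> span (w ` {..<n})" for n by simp
  have "independent (w ` {..<n}) \<and> card (w ` {..<n}) = n" for n
  proof (induction n)
    case 0
    show ?case by (simp add: independent_empty)
  next
    case (Suc n)
    have "independent (insert (w n) (w ` {..<n}))"
      using *[of n] Suc by (intro independent_insertI) simp_all
    moreover have "w n \<notin> w ` {..<n}"
      using *[of n] span_base[of "w n" "w ` {..<n}"] by argo
    ultimately show ?case
      using Suc by (simp add: lessThan_Suc)
  qed
  then have "independent (w ` {..<Suc (card B)})" "card (w ` {..<Suc (card B)}) = Suc (card B)"
    by blast+
  moreover have "w ` {..<Suc (card B)} \<subseteq> span B"
    using assms(2) by blast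
  ultimately show False
    using independent_span_bound[OF assms(1), of "w ` {..<Suc (card B)}"] by simp
qed

text \<open>Linearity is required on \<open>M\<close> only, because the action in a
  \<open>lie_module\<close> is unconstrained outside its carrier.\<close>

locale subspace_endomorphism = vector_space scale
  for scale :: "'f::field \<Rightarrow> 'v::ab_group_add \<Rightarrow> 'v" +
  fixes M :: "'v set" and T :: "'v \<Rightarrow> 'v"
  assumes subspace_M: "subspace M"
    and T_closed: "v \<in> M \<Longrightarrow> T v \<in> M"
    and T_add: "v \<in> M \<Longrightarrow> w \<in> M \<Longrightarrow> T (v + w) = T v + T w"
    and T_scale: "v \<in> M \<Longrightarrow> T (scale c v) = scale c (T v)"
begin

lemma T_zero: "T 0 = 0"
  using T_scale[of 0 0] subspace_0[OF subspace_M] by simp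

text \<open>Nonzero eigenvectors for distinct eigenvalues are independent, so a finite-dimensional
  space has no infinite sequence of them. This is what makes weight strings stop.\<close>

lemma eigenvector_sequence_vanishes:
  assumes "finite B" "M \<subseteq> span B"
    and w: "\<And>n::nat. w n \<in> M" "\<And>n. T (w n) = scale (c n) (w n)" and "inj c"
  shows "\<exists>n. w n = 0"
proof -
  \<comment> \<open>\<open>Q n\<close> is the product of the operators \<open>T - c i\<close> over
    \<open>i < n\<close>: it kills \<open>w i\<close> for \<open>i < n\<close> and multiplies
    \<open>w n\<close> by a nonzero scalar.\<close>
  define Q where "Q = rec_nat id (\<lambda>i g x. T (g x) - scale (c i) (g x))"
  have Q_0: "Q 0 x = x" and Q_Suc: "Q (Suc i) x = T (Q i x) - scale (c i) (Q i x)" for i x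
    by (simp_all add: Q_def)
  have Q_M: "Q n x \<in> M" if "x \<in> M" for n x
    by (induction n) (simp_all add: Q_0 Q_Suc that subspace_diff[OF subspace_M] T_closed
        subspace_scale[OF subspace_M])
  have Q_lin: "Q n (scale a x + y) = scale a (Q n x) + Q n y" if "x \<in> M" "y \<in> M" for n a x y
    by (induction n) (simp_all add: Q_0 Q_Suc that Q_M T_add T_scale subspace_scale[OF subspace_M]
        scale_right_distrib scale_right_diff_distrib scale_left_commute)
  have Q_w: "Q n (w i) = scale (\<Prod>j<n. c i - c j) (w i)" for n i
    by (induction n)
      (simp_all add: Q_0 Q_Suc T_scale w algebra_simps)
  obtain n where n: "w n \<in> span (w ` {..<n})"
    using sequence_meets_span[OF assms(1), of w] w(1) assms(2) by blast
  have "x \<in> M \<and> Q n x = 0" if "x \<in> span (w ` {..<n})" for x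
    using that
  proof (induction rule: span_induct_alt)
    case base
    have "Q n 0 = 0"
      by (induction n) (simp_all add: Q_0 Q_Suc T_zero)
    then show ?case using subspace_0[OF subspace_M] by simp
  next
    case (step a x y)
    then obtain i where "i < n" "x = w i" by auto
    then have "Q n x = 0" "x \<in> M" using w by (auto simp: Q_w)
    then show ?case
      using step by (simp add: Q_lin subspace_add[OF subspace_M] subspace_scale[OF subspace_M])
  qed
  then have "scale (\<Prod>j<n. c n - c j) (w n) = 0"
    using n Q_w by metis
  then have "w n = 0"
    using \<open>inj c\<close> by (auto simp: inj_def)
  then show ?thesis ..
qed

text \<open>The vector \<open>p(T) v\<close>, evaluated by Horner's scheme.\<close>

definition peval :: "'f poly \<Rightarrow> 'v \<Rightarrow> 'v" where
  "peval p v = fold_coeffs (\<lambda>a w. scale a v + T w) p 0"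

lemma peval_0: "peval 0 v = 0"
  by (simp add: peval_def)

lemma peval_pCons: "peval (pCons a p) v = scale a v + T (peval p v)"
  by (cases "p = 0 \<and> a = 0") (auto simp: peval_def T_zero)

lemma peval_closed: "v \<in> M \<Longrightarrow> peval p v \<in> M"
  by (induction p) (simp_all add: peval_0 peval_pCons T_closed subspace_M subspace_0 subspace_add
      subspace_scale)

lemma peval_add: "v \<in> M \<Longrightarrow> peval (p + q) v = peval p v + peval q v"
  by (induction p q rule: poly_induct2)
    (simp_all add: peval_0 peval_pCons T_add peval_closed scale_left_distrib)

lemma peval_smult: "v \<in> M \<Longrightarrow> peval (smult c p) v = scale c (peval p v)"
  by (induction p) (simp_all add: peval_0 peval_pCons T_scale peval_closed scale_right_distrib)

lemma peval_monom: "peval (monom 1 n) v = (T ^^ n) v"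
  by (induction n) (simp_all add: peval_0 peval_pCons monom_0 monom_Suc T_zero)

text \<open>Some \<open>(T ^^ n) v\<close> is a combination of the lower powers, and this relation
  is a monic polynomial of degree \<open>n\<close>.\<close>

lemma annihilator_exists:
  assumes "finite B" "M \<subseteq> span B" "v \<in> M"
  shows "\<exists>p. p \<noteq> 0 \<and> peval p v = 0"
proof -
  have "(T ^^ n) v \<in> M" for n
    using peval_closed[OF assms(3)] by (metis peval_monom)
  then obtain n where n: "(T ^^ n) v \<in> span ((\<lambda>i. (T ^^ i) v) ` {..<n})"
    using sequence_meets_span[OF assms(1), of "\<lambda>i. (T ^^ i) v"] assms(2) by blast
  \<comment> \<open>Bounding the coefficients instead of the degree keeps the case
    \<open>n = 0\<close> right, where \<open>p\<close> must be \<open>0\<close>.\<close>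
  have "\<exists>p. (\<forall>i\<ge>n. coeff p i = 0) \<and> x = peval p v"
    if "x \<in> span ((\<lambda>i. (T ^^ i) v) ` {..<n})" for x
    using that
  proof (induction rule: span_induct_alt)
    case base
    then show ?case by (intro exI[of _ 0]) (simp add: peval_0)
  next
    case (step c x y)
    then obtain i p where "i < n" "x = (T ^^ i) v" "\<forall>i\<ge>n. coeff p i = 0" "y = peval p v"
      by auto
    then show ?case
      using assms(3)
      by (intro exI[of _ "smult c (monom 1 i) + p"]) (auto simp: peval_add peval_smult peval_monom)
  qed
  then obtain p where p: "\<forall>i\<ge>n. coeff p i = 0" "(T ^^ n) v = peval p v"
    using n by blast
  have "coeff (monom 1 n + smult (- 1) p) n = 1"
    using p(1) by simp
  then have "monom 1 n + smult (- 1) p \<noteq> 0" by auto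
  moreover have "peval (monom 1 n + smult (- 1) p) v = 0"
    unfolding peval_add[OF assms(3)] peval_smult[OF assms(3)] peval_monom p(2) by simp
  ultimately show ?thesis by blast
qed

end

text \<open>Split a linear factor off an annihilating polynomial, \<open>p = [:- c, 1:] * q\<close>.
  Either \<open>peval q v\<close> is an eigenvector, or it is \<open>0\<close> and \<open>q\<close>
  is an annihilator of smaller degree.\<close>

lemma eigenvector_exists:
  fixes scale :: "'f::alg_closed_field \<Rightarrow> 'v::ab_group_add \<Rightarrow> 'v"
  assumes "subspace_endomorphism scale M T"
    and "finite B" "M \<subseteq> module.span scale B" "v \<in> M" "v \<noteq> 0"
  shows "\<exists>c u. u \<in> M \<and> u \<noteq> 0 \<and> T u = scale c u"
proof -
  interpret subspace_endomorphism scale M T by fact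
  obtain p where "p \<noteq> 0" "peval p v = 0"
    using annihilator_exists[OF assms(2-4)] by blast
  then show ?thesis
  proof (induction "degree p" arbitrary: p rule: less_induct)
    case less
    show ?case
    proof (cases "degree p = 0")
      case True
      then obtain a where "p = [:a:]" by (metis degree_eq_zeroE)
      then show ?thesis
        using less.prems \<open>v \<noteq> 0\<close> by (simp add: peval_pCons peval_0 T_zero)
    next
      case False
      then obtain c where "poly p c = 0"
        using alg_closed_imp_poly_has_root by blast
      then obtain q where p: "p = [:- c, 1:] * q"
        by (metis poly_eq_0_iff_dvd dvdE)
      then have "q \<noteq> 0" using less.prems by auto
      then have deg: "degree q < degree p"
        unfolding p by (subst degree_mult_eq) auto
      have "peval p v = T (peval q v) - scale c (peval q v)"
        by (simp add: p peval_add[OF \<open>v \<in> M\<close>] peval_smult[OF \<open>v \<in> M\<close>] peval_pCons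
            flip: smult_minus_left)
      then have T: "T (peval q v) = scale c (peval q v)"
        using less.prems by simp
      show ?thesis
      proof (cases "peval q v = 0")
        case True
        then show ?thesis using less.hyps deg \<open>q \<noteq> 0\<close> by blast
      next
        case False
        then show ?thesis using T peval_closed[OF \<open>v \<in> M\<close>] by blast
      qed
    qed
  qed
qed

lemma (in lie_module) endomorphism_act: "subspace_endomorphism sV M (act x)"
  by unfold_locales (simp_all add: subspace_carrier act_closed act_add_right act_scale_right)

section \<open>Finite-dimensional modules for sl2\<close>

context lie_module
begin

lemma act_zero_right: "act x 0 = 0"
  using act_scale_right[of 0 x 0] V.subspace_0[OF subspace_carrier] by simp

lemma act_minus_right: "v \<in> M \<Longrightarrow> act x (- v) = - act x v"
  using act_scale_right[of v x "- 1"] by simp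

lemma act_diff_right: "v \<in> M \<Longrightarrow> w \<in> M \<Longrightarrow> act x (v - w) = act x v - act x w"
  using act_add_right[of v "- w" x] V.subspace_neg[OF subspace_carrier, of w]
  by (simp add: act_minus_right)

lemma act_zero_left: "v \<in> M \<Longrightarrow> act 0 v = 0"
  using act_scale_left[of v 0 0] by simp

lemma act_minus_left: "v \<in> M \<Longrightarrow> act (- x) v = - act x v"
  using act_scale_left[of v "- 1" x] by simp

lemma act_diff_left: "v \<in> M \<Longrightarrow> act (x - y) v = act x v - act y v"
  using act_add_left[of v x "- y"] by (simp add: act_minus_left)

lemmas act_simps = act_closed act_add_right act_diff_right act_minus_right act_scale_right
  act_zero_right act_add_left act_diff_left act_minus_left act_scale_left act_zero_left

end

locale sl2_module = lie_module sl2_scale sl2_bracket sV M act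
  for sV :: "'f::field_char_0 \<Rightarrow> 'v::ab_group_add \<Rightarrow> 'v" and M act
begin

abbreviation "ee \<equiv> act sl2_e"
abbreviation "ff \<equiv> act sl2_f"
abbreviation "hh \<equiv> act sl2_h"

lemma
  assumes "v \<in> M"
  shows hh_ee: "hh (ee v) = ee (hh v) + sV 2 (ee v)"
    and hh_ff: "hh (ff v) = ff (hh v) - sV 2 (ff v)"
    and ee_ff: "ee (ff v) = ff (ee v) + hh v"
  using act_bracket[OF assms, of sl2_h sl2_e] act_bracket[OF assms, of sl2_h sl2_f]
    act_bracket[OF assms, of sl2_e sl2_f]
  by (simp_all add: sl2_brackets act_simps assms algebra_simps)

lemma act_decomp: "v \<in> M \<Longrightarrow> act (p, q, r) v = sV p (ee v) + sV q (ff v) + sV r (hh v)"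
  using act_add_left[of v "sl2_scale p sl2_e + sl2_scale q sl2_f" "sl2_scale r sl2_h"]
    act_add_left[of v "sl2_scale p sl2_e" "sl2_scale q sl2_f"]
  by (simp add: act_scale_left) (simp add: sl2_e_def sl2_f_def sl2_h_def)

context
  fixes v \<mu>
  assumes v: "v \<in> M" "ee v = 0" "hh v = sV \<mu> v"
begin

lemma ff_pow_closed: "(ff ^^ n) v \<in> M"
  by (induction n) (simp_all add: v act_closed)

lemma hh_ff_pow: "hh ((ff ^^ n) v) = sV (\<mu> - 2 * of_nat n) ((ff ^^ n) v)"
proof (induction n)
  case (Suc n)
  then show ?case
    by (simp add: hh_ff ff_pow_closed act_scale_right) (simp add: algebra_simps)
qed (simp add: v)

text \<open>Moving \<open>ee\<close> past one \<open>ff\<close> costs one \<open>hh\<close>, and the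
  weights \<open>\<mu> - 2 j\<close> for \<open>j \<le> n\<close> add up to the coefficient.\<close>

lemma ee_ff_pow: "ee ((ff ^^ Suc n) v) = sV (of_nat (Suc n) * (\<mu> - of_nat n)) ((ff ^^ n) v)"
proof (induction n)
  case 0
  show ?case by (simp add: ee_ff v act_zero_right)
next
  case (Suc n)
  have "ee ((ff ^^ Suc (Suc n)) v) = ff (ee ((ff ^^ Suc n) v)) + hh ((ff ^^ Suc n) v)"
    using ee_ff[OF ff_pow_closed[of "Suc n"]] by simp
  also have "\<dots> = sV (of_nat (Suc n) * (\<mu> - of_nat n) + (\<mu> - 2 * of_nat (Suc n))) ((ff ^^ Suc n) v)"
    unfolding Suc hh_ff_pow
    by (simp add: act_scale_right ff_pow_closed flip: V.scale_left_distrib)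
  also have "of_nat (Suc n) * (\<mu> - of_nat n) + (\<mu> - 2 * of_nat (Suc n))
      = of_nat (Suc (Suc n)) * (\<mu> - of_nat (Suc n))"
    by (simp add: algebra_simps)
  finally show ?case .
qed

text \<open>In characteristic 0 the string \<open>(ff ^^ n) v\<close> has distinct weights, so it
  reaches \<open>0\<close>. Applying \<open>ee\<close> to its first zero term leaves
  \<open>(d + 1) (\<mu> - d) = 0\<close>.\<close>

lemma highest_weight:
  assumes "finite B" "M \<subseteq> V.span B" "v \<noteq> 0"
  shows "\<exists>d. \<mu> = of_nat d \<and> (ff ^^ Suc d) v = 0"
proof -
  have "inj (\<lambda>n. \<mu> - 2 * of_nat n :: 'f)"
    by (auto simp: inj_def)
  then have "\<exists>n. (ff ^^ n) v = 0"
    using subspace_endomorphism.eigenvector_sequence_vanishes[where w = "\<lambda>n. (ff ^^ n) v",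
        OF endomorphism_act assms(1,2) ff_pow_closed hh_ff_pow] by blast
  then obtain d where "(ff ^^ d) v \<noteq> 0" "(ff ^^ Suc d) v = 0"
    using \<open>v \<noteq> 0\<close> exists_least_lemma[of "\<lambda>n. (ff ^^ n) v = 0"] by auto
  moreover from this have "of_nat (Suc d) * (\<mu> - of_nat d) = 0"
    using ee_ff_pow[of d] by (auto simp: act_zero_right simp del: of_nat_Suc)
  ultimately show ?thesis
    by (intro exI[of _ d]) (auto simp del: of_nat_Suc)
qed

end

end

section \<open>The endomorphism space as a finite-dimensional module\<close>

text \<open>The action is by commutators. With the whole type as carrier, endomorphisms are ordinary
  linear functions, equal when they agree everywhere.\<close>

lemma (in lie_module) lie_module_End:
  assumes "M = UNIV"
  shows "lie_module sL br (\<lambda>c T v. sV c (T v)) {T. Vector_Spaces.linear sV sV T}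
    (\<lambda>x T v. act x (T v) - T (act x v))"
proof -
  note [simp] = act_simps[unfolded assms, simplified]
  have vs: "vector_space (\<lambda>c (T :: 'v \<Rightarrow> 'v) v. sV c (T v))"
    by unfold_locales (simp_all add: fun_eq_iff algebra_simps)
  interpret E: vector_space "\<lambda>c (T :: 'v \<Rightarrow> 'v) v. sV c (T v)" by fact
  have linear: "Vector_Spaces.linear sV sV T \<longleftrightarrow>
      (\<forall>v w. T (v + w) = T v + T w) \<and> (\<forall>c v. T (sV c v) = sV c (T v))" for T
    by (simp add: Vector_Spaces.linear_iff V.vector_space_axioms)
  have sub: "E.subspace {T. (\<forall>v w. T (v + w) = T v + T w) \<and> (\<forall>c v. T (sV c v) = sV c (T v))}"
    unfolding E.subspace_def by (auto simp: algebra_simps)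
  have diff: "T (v - w) = T v - T w" if "\<forall>v w. T (v + w) = T v + T w" for T :: "'v \<Rightarrow> 'v" and v w
    using that[rule_format, of "v - w" w] by (simp add: algebra_simps)
  show ?thesis
    by unfold_locales
      (auto simp: linear sub diff assms act_bracket fun_eq_iff algebra_simps)
qed

lemma (in vector_space) linear_maps_finitely_spanned:
  assumes "finite B" "span B = UNIV"
  shows "\<exists>C. finite C \<and>
    {T. Vector_Spaces.linear scale scale T} \<subseteq> module.span (\<lambda>c (T :: 'b \<Rightarrow> 'b) v. scale c (T v)) C"
proof -
  obtain B' where "B' \<subseteq> B" "independent B'" "B \<subseteq> span B'"
    using maximal_independent_subset by blast
  then have fin: "finite B'" and ind: "independent B'" and UNIV: "span B' = UNIV"
    using assms finite_subset span_mono[of B "span B'"] by (auto simp: span_span)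
  interpret E: vector_space "\<lambda>c (T :: 'b \<Rightarrow> 'b) v. scale c (T v)"
    by unfold_locales (simp_all add: fun_eq_iff algebra_simps)
  \<comment> \<open>\<open>C b b'\<close> is the matrix unit that sends \<open>b\<close> to
    \<open>b'\<close> and the other basis vectors to \<open>0\<close>.\<close>
  define C where "C b b' v = scale (representation B' v b) b'" for b b' v
  have "T \<in> E.span ((\<lambda>(b, b'). C b b') ` (B' \<times> B'))" if T: "Vector_Spaces.linear scale scale T" for T
  proof -
    interpret T: Vector_Spaces.linear scale scale T by fact
    have expand: "v = (\<Sum>b\<in>B'. scale (representation B' v b) b)" for v
      using sum_representation_eq[OF ind, of v B'] fin UNIV by simp
    have sum_apply: "(\<Sum>a\<in>A. F a) v = (\<Sum>a\<in>A. F a v)" for A v and F :: "'b \<Rightarrow> 'b \<Rightarrow> 'b"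
      by (induction A rule: infinite_finite_induct) simp_all
    have "T v = (\<Sum>b\<in>B'. \<Sum>b'\<in>B'. scale (representation B' (T b) b') (C b b' v))" for v
    proof -
      have "T v = (\<Sum>b\<in>B'. scale (representation B' v b) (T b))"
        by (subst expand[of v]) (simp add: T.sum T.scale)
      also have "\<dots> = (\<Sum>b\<in>B'. \<Sum>b'\<in>B'. scale (representation B' (T b) b') (C b b' v))"
      proof (intro sum.cong refl)
        fix b
        have "scale (representation B' v b) (T b) =
            scale (representation B' v b) (\<Sum>b'\<in>B'. scale (representation B' (T b) b') b')"
          using expand[of "T b"] by simp
        then show "scale (representation B' v b) (T b) =
            (\<Sum>b'\<in>B'. scale (representation B' (T b) b') (C b b' v))"
          by (simp add: C_def scale_sum_right mult.commute)
      qed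
      finally show ?thesis .
    qed
    then have "T = (\<Sum>b\<in>B'. \<Sum>b'\<in>B'. (\<lambda>v. scale (representation B' (T b) b') (C b b' v)))"
      unfolding fun_eq_iff sum_apply by blast
    also have "\<dots> \<in> E.span ((\<lambda>(b, b'). C b b') ` (B' \<times> B'))"
      by (intro E.span_sum E.span_scale E.span_base) auto
    finally show ?thesis .
  qed
  then have "{T. Vector_Spaces.linear scale scale T} \<subseteq> E.span ((\<lambda>(b, b'). C b b') ` (B' \<times> B'))"
    by blast
  moreover have "finite ((\<lambda>(b, b'). C b b') ` (B' \<times> B'))"
    using fin by (intro finite_imageI finite_cartesian_product)
  ultimately show ?thesis by blast
qed

section \<open>Irreducible modules for sl2\<close>

lemma isomorphic_modules_sym:
  assumes "lie_module sL br sV M actV" and "isomorphic_modules sV M actV sW N actW"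
  shows "isomorphic_modules sW N actW sV M actV"
proof -
  interpret lie_module sL br sV M actV by fact
  obtain \<phi> where bij: "bij_betw \<phi> M N"
    and hom: "\<And>v w. v \<in> M \<Longrightarrow> w \<in> M \<Longrightarrow> \<phi> (v + w) = \<phi> v + \<phi> w"
      "\<And>c v. v \<in> M \<Longrightarrow> \<phi> (sV c v) = sW c (\<phi> v)"
      "\<And>x v. v \<in> M \<Longrightarrow> \<phi> (actV x v) = actW x (\<phi> v)"
    using assms(2) unfolding isomorphic_modules_def module_iso_def by blast
  define \<psi> where "\<psi> = inv_into M \<phi>"
  have \<psi>_M: "\<psi> w \<in> M" and \<phi>_\<psi>: "\<phi> (\<psi> w) = w" if "w \<in> N" for w
    using that bij unfolding \<psi>_def bij_betw_def by (auto simp: inv_into_into f_inv_into_f)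
  have \<psi>_\<phi>: "\<psi> (\<phi> v) = v" if "v \<in> M" for v
    using that bij unfolding \<psi>_def bij_betw_def by auto
  have "bij_betw \<psi> N M"
    unfolding \<psi>_def by (rule bij_betw_inv_into[OF bij])
  moreover have "\<psi> (v + w) = \<psi> v + \<psi> w" if "v \<in> N" "w \<in> N" for v w
  proof -
    have "\<psi> (\<phi> (\<psi> v + \<psi> w)) = \<psi> v + \<psi> w"
      by (intro \<psi>_\<phi> V.subspace_add[OF subspace_carrier] \<psi>_M that)
    then show ?thesis using that by (simp add: hom \<psi>_M \<phi>_\<psi>)
  qed
  moreover have "\<psi> (sW c v) = sV c (\<psi> v)" if "v \<in> N" for c v
  proof -
    have "\<psi> (\<phi> (sV c (\<psi> v))) = sV c (\<psi> v)"
      by (intro \<psi>_\<phi> V.subspace_scale[OF subspace_carrier] \<psi>_M that)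
    then show ?thesis using that by (simp add: hom \<psi>_M \<phi>_\<psi>)
  qed
  moreover have "\<psi> (actW x v) = actV x (\<psi> v)" if "v \<in> N" for x v
  proof -
    have "\<psi> (\<phi> (actV x (\<psi> v))) = actV x (\<psi> v)"
      by (intro \<psi>_\<phi> act_closed \<psi>_M that)
    then show ?thesis using that by (simp add: hom \<psi>_M \<phi>_\<psi>)
  qed
  ultimately show ?thesis
    unfolding isomorphic_modules_def module_iso_def by blast
qed

text \<open>The monomial of degree \<open>i\<close> is sent to a multiple of
  \<open>(ff ^^ i) v\<close>. The kernel is a submodule of the irreducible \<open>Vd d\<close> that
  misses \<open>1\<close>, and the image is a submodule of the irreducible \<open>M\<close> that
  contains \<open>v\<close>.\<close>

lemma (in sl2_module) isomorphic_Vd_if_highest_weight_vector: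
  assumes irr: irreducible_module
    and v: "v \<in> M" "v \<noteq> 0" "ee v = 0" "hh v = sV (of_nat d) v" "(ff ^^ Suc d) v = 0"
  shows "isomorphic_modules smult (Vd d) (sl2_act d) sV M act"
proof -
  interpret D: sl2_module "smult :: 'f \<Rightarrow> _" "Vd d" "sl2_act d"
    by (intro sl2_module.intro lie_module_Vd)
  \<comment> \<open>Since f takes the monomial of degree \<open>i\<close> to \<open>d - i\<close>
    times the next one, \<open>(ff ^^ i) v\<close> must be divided by
    \<open>d (d - 1) ... (d - i + 1)\<close>. For \<open>i > d\<close> this product is
    \<open>0\<close>, and \<open>inverse 0 = 0\<close> makes \<open>c i\<close> vanish.\<close>
  define c :: "nat \<Rightarrow> 'f" where "c i = inverse (\<Prod>j<i. of_nat d - of_nat j)" for i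
  have c_0: "c 0 = 1" and c_Suc: "(of_nat d - of_nat i) * c (Suc i) = (if i = d then 0 else c i)" for i
    by (auto simp: c_def)
  have c_big: "c i = 0" if "i > d" for i
    using that by (auto simp: c_def)
  define u where "u i = sV (c i) ((ff ^^ i) v)" for i
  note closed = ff_pow_closed[OF v(1,3,4)]
  have u_M: "u i \<in> M" for i
    by (simp add: u_def closed V.subspace_scale[OF subspace_carrier])
  have ff_u: "ff (u i) = sV (of_nat d - of_nat i) (u (Suc i))" for i
    using v(5) c_big[of i] by (cases i d rule: linorder_cases)
      (simp_all add: u_def act_scale_right act_zero_right closed c_Suc)
  have hh_u: "hh (u i) = sV (of_nat d - 2 * of_nat i) (u i)" for i
    by (simp add: u_def act_scale_right closed hh_ff_pow[OF v(1,3,4)] mult.commute)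
  have ee_u: "ee (u i) = sV (of_nat i) (u (i - 1))" if "i \<le> d" for i
  proof (cases i)
    case 0
    then show ?thesis by (simp add: u_def c_0 v)
  next
    case (Suc n)
    then have "(of_nat d - of_nat n) * c (Suc n) = c n"
      using that by (simp add: c_Suc)
    then show ?thesis
      using ee_ff_pow[OF v(1,3,4), of n]
      by (simp add: Suc u_def act_scale_right closed[of "Suc n", simplified] mult_ac
          del: of_nat_Suc)
  qed
  define \<psi> where "\<psi> p = (\<Sum>i\<le>d. sV (coeff p i) (u i))" for p
  have \<psi>_add: "\<psi> (p + q) = \<psi> p + \<psi> q" for p q
    by (simp add: \<psi>_def V.scale_left_distrib sum.distrib)
  have \<psi>_smult: "\<psi> (smult a p) = sV a (\<psi> p)" for a p
    by (simp add: \<psi>_def V.scale_sum_right)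
  have \<psi>_diff: "\<psi> (p - q) = \<psi> p - \<psi> q" for p q
    using \<psi>_add[of "p - q" q] by (simp add: algebra_simps)
  have \<psi>_0: "\<psi> 0 = 0"
    by (simp add: \<psi>_def)
  have \<psi>_M: "\<psi> p \<in> M" for p
    unfolding \<psi>_def
    by (intro V.subspace_sum[OF subspace_carrier] V.subspace_scale[OF subspace_carrier] u_M)
  have \<psi>_monom: "\<psi> (monom 1 i) = u i" for i
  proof (cases "i \<le> d")
    case True
    have "\<psi> (monom 1 i) = (\<Sum>j\<le>d. if j = i then u i else 0)"
      unfolding \<psi>_def by (intro sum.cong) auto
    then show ?thesis using True by simp
  next
    case False
    then show ?thesis by (auto simp: \<psi>_def u_def c_big)
  qed
  \<comment> \<open>Membership in \<open>Vd d\<close> is carried through the induction because the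
    action is additive only on the carrier.\<close>
  have "p \<in> Vd d \<and> \<psi> (sl2_act d x p) = act x (\<psi> p)"
    if "p \<in> D.V.span (monom 1 ` {..d})" for x p
    using that
  proof (induction rule: D.V.span_induct_alt)
    case base
    show ?case
      by (simp add: D.act_zero_right act_zero_right \<psi>_0 D.V.subspace_0[OF D.subspace_carrier]
          del: sl2_act.simps)
  next
    case (step a p q)
    then obtain i where i: "p = monom 1 i" "i \<le> d" by auto
    obtain k l m where x: "x = (k, l, m)" by (cases x)
    have p: "p \<in> Vd d" using i by (simp add: Vd_def degree_monom_eq)
    have "\<psi> (sl2_act d x p) = act x (u i)"
      unfolding x D.act_decomp[OF p] act_decomp[OF u_M]
      by (simp add: \<psi>_add \<psi>_smult sl2_act_monom \<psi>_monom ff_u ee_u hh_u i del: sl2_act.simps)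
    moreover have "smult a p \<in> Vd d" "sV a (u i) \<in> M"
      by (intro V.subspace_scale[OF subspace_carrier] D.V.subspace_scale[OF D.subspace_carrier]
          u_M p)+
    moreover from this have "smult a p + q \<in> Vd d"
      using D.V.subspace_add[OF D.subspace_carrier] step.IH by blast
    moreover have "\<psi> p = u i"
      by (simp add: i \<psi>_monom)
    ultimately show ?case
      using step.IH p \<psi>_M[of q] u_M[of i]
      by (simp add: \<psi>_add \<psi>_smult D.act_add_right D.act_scale_right act_add_right
          act_scale_right del: sl2_act.simps)
  qed
  then have \<psi>_act: "\<psi> (sl2_act d x p) = act x (\<psi> p)" if "p \<in> Vd d" for x p
    using that unfolding Vd_eq_span by blast
  have "inj_on \<psi> (Vd d)"
  proof -
    let ?K = "{p \<in> Vd d. \<psi> p = 0}"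
    have "D.submodule ?K"
      unfolding D.submodule_def D.V.subspace_def
      using D.subspace_carrier[unfolded D.V.subspace_def]
      by (auto simp: \<psi>_0 \<psi>_add \<psi>_smult \<psi>_act act_zero_right D.act_closed simp del: sl2_act.simps)
    moreover have "1 \<in> Vd d" "\<psi> 1 \<noteq> 0"
      using \<psi>_monom[of 0] v by (simp_all add: Vd_def u_def c_0)
    then have "?K \<noteq> Vd d" by blast
    ultimately have K: "?K = {0}"
      using irreducible_Vd[where 'f = 'f, of d] unfolding D.irreducible_module_def by blast
    show ?thesis
    proof (rule inj_onI)
      fix p q assume "p \<in> Vd d" "q \<in> Vd d" "\<psi> p = \<psi> q"
      then have "p - q \<in> ?K"
        by (simp add: \<psi>_diff D.V.subspace_diff[OF D.subspace_carrier])
      then show "p = q" unfolding K by simp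
    qed
  qed
  moreover have "\<psi> ` Vd d = M"
  proof -
    have "submodule (\<psi> ` Vd d)"
      unfolding submodule_def
    proof (intro conjI allI ballI)
      show "V.subspace (\<psi> ` Vd d)"
        unfolding V.subspace_def
      proof (intro conjI ballI allI)
        show "0 \<in> \<psi> ` Vd d"
          using D.V.subspace_0[OF D.subspace_carrier] \<psi>_0 by (metis imageI)
        fix x assume "x \<in> \<psi> ` Vd d"
        then obtain p where p: "p \<in> Vd d" "x = \<psi> p" by blast
        show "sV c x \<in> \<psi> ` Vd d" for c
          using D.V.subspace_scale[OF D.subspace_carrier p(1), of c] p \<psi>_smult[of c p]
          by (metis imageI)
        fix y assume "y \<in> \<psi> ` Vd d"
        then obtain q where q: "q \<in> Vd d" "y = \<psi> q" by blast
        show "x + y \<in> \<psi> ` Vd d"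
          using D.V.subspace_add[OF D.subspace_carrier p(1) q(1)] p q \<psi>_add[of p q]
          by (metis imageI)
      qed
      show "\<psi> ` Vd d \<subseteq> M" using \<psi>_M by blast
      fix x y assume "y \<in> \<psi> ` Vd d"
      then obtain p where p: "p \<in> Vd d" "y = \<psi> p" by blast
      show "act x y \<in> \<psi> ` Vd d"
        unfolding p(2) \<psi>_act[OF p(1), symmetric] by (intro imageI D.act_closed p(1))
    qed
    moreover have "v \<in> \<psi> ` Vd d"
      using \<psi>_monom[of 0] by (auto simp: u_def c_0 Vd_def intro!: image_eqI[of _ _ 1])
    then have "\<psi> ` Vd d \<noteq> {0}" using v(2) by blast
    ultimately show ?thesis
      using irr unfolding irreducible_module_def by blast
  qed
  ultimately have "bij_betw \<psi> (Vd d) M"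
    by (simp add: bij_betw_def)
  then show ?thesis
    unfolding isomorphic_modules_def module_iso_def
    by (intro exI[of _ \<psi>]) (simp add: \<psi>_add \<psi>_smult \<psi>_act del: sl2_act.simps)
qed

text \<open>Start from any eigenvector of \<open>hh\<close>. Each \<open>ee\<close> raises the
  eigenvalue by 2, so the string ends, and its last nonzero term is a highest weight vector.\<close>

theorem irreducible_sl2_module_isomorphic_Vd:
  fixes sV :: "'f::{alg_closed_field, field_char_0} \<Rightarrow> 'v::ab_group_add \<Rightarrow> 'v"
  assumes "lie_module sl2_scale sl2_bracket sV M act"
    and "lie_module.finite_dim sV M"
    and "lie_module.irreducible_module sV M act"
  shows "\<exists>d. isomorphic_modules sV M act smult (Vd d) (sl2_act d)"
proof -
  interpret sl2_module sV M act by (intro sl2_module.intro assms)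
  obtain B where B: "finite B" "V.span B = M"
    using assms(2) unfolding finite_dim_def by blast
  obtain w where "w \<in> M" "w \<noteq> 0"
    using assms(3) V.subspace_0[OF subspace_carrier] unfolding irreducible_module_def by blast
  then obtain c u where u: "u \<in> M" "u \<noteq> 0" "hh u = sV c u"
    using eigenvector_exists[OF endomorphism_act B(1)] B(2) by blast
  have closed: "(ee ^^ n) u \<in> M" for n
    by (induction n) (simp_all add: u act_closed)
  have eigen: "hh ((ee ^^ n) u) = sV (c + 2 * of_nat n) ((ee ^^ n) u)" for n
  proof (induction n)
    case (Suc n)
    then show ?case
      by (simp add: hh_ee closed act_scale_right) (simp add: algebra_simps)
  qed (simp add: u)
  have "inj (\<lambda>n. c + 2 * of_nat n)"
    by (auto simp: inj_def)
  then have "\<exists>n. (ee ^^ n) u = 0"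
    using subspace_endomorphism.eigenvector_sequence_vanishes[where w = "\<lambda>n. (ee ^^ n) u",
        OF endomorphism_act B(1) _ closed eigen] B(2) by blast
  then obtain n where n: "(ee ^^ n) u \<noteq> 0" "(ee ^^ Suc n) u = 0"
    using \<open>u \<noteq> 0\<close> exists_least_lemma[of "\<lambda>n. (ee ^^ n) u = 0"] by auto
  obtain d where d: "c + 2 * of_nat n = of_nat d" "(ff ^^ Suc d) ((ee ^^ n) u) = 0"
    using highest_weight[OF closed _ eigen B(1) _ n(1)] n(2) B(2) by auto
  have "ee ((ee ^^ n) u) = 0" using n(2) by simp
  moreover have "hh ((ee ^^ n) u) = sV (of_nat d) ((ee ^^ n) u)"
    unfolding eigen d(1) ..
  ultimately have "isomorphic_modules smult (Vd d) (sl2_act d) sV M act"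
    using isomorphic_Vd_if_highest_weight_vector[OF assms(3) closed n(1)] d(2) by blast
  then have "isomorphic_modules sV M act smult (Vd d) (sl2_act d)"
    by (rule isomorphic_modules_sym[OF lie_module_Vd])
  then show ?thesis ..
qed

section \<open>Equitable triples\<close>

text \<open>Antisymmetry leaves only the 2 by 2 minors of the coefficients, as in a cross
  product.\<close>

lemma (in lie_algebra) bracket_combination:
  "bracket (scale a x + scale b y + scale c z) (scale a' x + scale b' y + scale c' z) =
     scale (a * b' - b * a') (bracket x y) + scale (b * c' - c * b') (bracket y z) +
     scale (c * a' - a * c') (bracket z x)"
proof -
  have anti: "bracket v u = - bracket u v" for u v
  proof -
    have "bracket (u + v) (u + v) = bracket u v + bracket v u"
      unfolding bracket_add_left bracket_add_right by (simp add: bracket_self)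
    then show ?thesis by (simp add: bracket_self eq_neg_iff_add_eq_0 add.commute)
  qed
  show ?thesis
    by (simp add: bracket_add_left bracket_add_right bracket_scale_left bracket_scale_right
        bracket_self anti[of x y] anti[of y z] anti[of z x] algebra_simps)
qed

text \<open>\<open>sl2_x\<close>, \<open>sl2_y\<close>, \<open>sl2_z\<close> is the equitable basis
  of sl2, and these three relations are its structure constants. By relation (ii), every directed
  triangle in the tetrahedron gives such a triple.\<close>

lemma equitable_triple_hom:
  fixes scale :: "'f::field_char_0 \<Rightarrow> 'l::ab_group_add \<Rightarrow> 'l"
  assumes "lie_algebra scale bracket"
    and xy: "bracket x y = scale 2 x + scale 2 y"
    and yz: "bracket y z = scale 2 y + scale 2 z"
    and zx: "bracket z x = scale 2 z + scale 2 x"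
  shows "\<exists>\<phi>. lie_hom sl2_scale sl2_bracket scale bracket \<phi> \<and>
    \<phi> sl2_x = x \<and> \<phi> sl2_y = y \<and> \<phi> sl2_z = z"
proof -
  interpret lie_algebra scale bracket by fact
  interpret S: lie_algebra "sl2_scale :: 'f \<Rightarrow> _" sl2_bracket by (rule lie_algebra_sl2)
  \<comment> \<open>Coordinates are converted by \<open>e = (x + z) / 2\<close>,
    \<open>f = - (y + z) / 2\<close> and \<open>h = z\<close>.\<close>
  define \<phi> where "\<phi> = (\<lambda>(p, q, r). scale (p / 2) x + scale (- q / 2) y + scale (p / 2 - q / 2 + r) z)"
  have br: "\<phi> (sl2_bracket u w) = bracket (\<phi> u) (\<phi> w)" for u w
  proof -
    obtain p q r p' q' r' where "u = (p, q, r)" "w = (p', q', r')"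
      by (cases u; cases w) auto
    moreover have "scale A (scale 2 x + scale 2 y) + scale B (scale 2 y + scale 2 z) +
        scale C (scale 2 z + scale 2 x) =
        scale (2 * (A + C)) x + scale (2 * (A + B)) y + scale (2 * (B + C)) z" for A B C
      by (simp add: algebra_simps)
    ultimately show ?thesis
      unfolding \<phi>_def
      by (simp only: prod.case sl2_bracket.simps bracket_combination xy yz zx)
        (intro arg_cong2[where f = "(+)"] arg_cong2[where f = scale] refl; simp add: field_simps)
  qed
  have add: "\<phi> (u + w) = \<phi> u + \<phi> w" and scale: "\<phi> (sl2_scale c u) = scale c (\<phi> u)" for c u w
    by (cases u; cases w; simp add: \<phi>_def algebra_simps add_divide_distrib diff_divide_distrib)+
  have "lie_hom sl2_scale sl2_bracket scale bracket \<phi>"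
    by unfold_locales (fact add scale br)+
  moreover have "\<phi> sl2_x = x" "\<phi> sl2_y = y" "\<phi> sl2_z = z"
    by (simp_all add: \<phi>_def sl2_basis_simps)
  ultimately show ?thesis by blast
qed

lemma (in lie_module) lie_module_pullback:
  assumes "lie_hom s b sL br \<phi>"
  shows "lie_module s b sV M (\<lambda>x. act (\<phi> x))"
proof -
  interpret H: lie_hom s b sL br \<phi> by fact
  show ?thesis
    by unfold_locales (simp_all add: act_simps act_bracket H.add H.scale H.hom_bracket subspace_carrier)
qed


section \<open>Modules for the tetrahedron algebra\<close>

locale tetra_module = lie_module tetra_scale tetra_bracket sV M act
  for sV :: "'f::field_char_0 \<Rightarrow> 'v::ab_group_add \<Rightarrow> 'v" and M act
begin

abbreviation "X i j \<equiv> act (tetra_x i j)"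

lemma X_swap:
  assumes "i \<noteq> j" "v \<in> M"
  shows "X j i v = - X i j v"
proof -
  have "tetra_x j i = - (tetra_x i j :: 'f tetra)"
    using tetra_relation_1[of j i] assms by (simp add: eq_neg_iff_add_eq_0)
  then show ?thesis by (simp add: act_minus_left assms)
qed

lemma X_commute:
  assumes "distinct [i, j, k]" "v \<in> M"
  shows "X i j (X j k v) = X j k (X i j v) + sV 2 (X i j v) + sV 2 (X j k v)"
  using act_bracket[OF assms(2), of "tetra_x i j" "tetra_x j k"] assms(2)
  by (simp add: tetra_relation_2[OF assms(1)] act_simps algebra_simps)

text \<open>Relation (ii) along the path \<open>j, i, k\<close>, with the sign of
  \<open>X j i\<close> reversed.\<close>

lemma X_commute_source:
  assumes "distinct [i, j, k]" "v \<in> M"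
  shows "X i j (X i k v) = X i k (X i j v) + sV 2 (X i j v) - sV 2 (X i k v)"
proof -
  have "X j i (X i k v) = X i k (X j i v) + sV 2 (X j i v) + sV 2 (X i k v)"
    using X_commute[of j i k v] assms by auto
  moreover have "X j i w = - X i j w" if "w \<in> M" for w
    using X_swap[of i j w] assms that by auto
  ultimately have "- X i j (X i k v) = - X i k (X i j v) - sV 2 (X i j v) + sV 2 (X i k v)"
    using assms by (simp add: act_simps)
  then show ?thesis by (simp add: algebra_simps)
qed

lemma X_commute_target:
  assumes "distinct [i, j, k]" "v \<in> M"
  shows "X i k (X j k v) = X j k (X i k v) + sV 2 (X j k v) - sV 2 (X i k v)"
proof -
  have "X j k (X k i v) = X k i (X j k v) + sV 2 (X j k v) + sV 2 (X k i v)"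
    using X_commute[of j k i v] assms by auto
  moreover have "X k i w = - X i k w" if "w \<in> M" for w
    using X_swap[of i k w] assms that by auto
  ultimately show ?thesis
    using assms by (simp add: act_simps algebra_simps)
qed

text \<open>If \<open>X i j\<close> is zero, relation (ii) reduces to \<open>2 X j k = 0\<close>.
  Walking along \<open>i, j, p, q\<close> therefore reaches every edge.\<close>

lemma X_vanishes_transfer:
  assumes "i \<noteq> j" "\<forall>v\<in>M. X i j v = 0" "p \<noteq> q"
  shows "\<forall>v\<in>M. X p q v = 0"
proof -
  have swap: "\<forall>v\<in>M. X j i v = 0" if "\<forall>v\<in>M. X i j v = 0" "i \<noteq> j" for i j
    using that X_swap[of i j] by simp
  have next_edge: "\<forall>v\<in>M. X j k v = 0" if "\<forall>v\<in>M. X i j v = 0" "i \<noteq> j" "j \<noteq> k" for i j k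
  proof (cases "k = i")
    case False
    then show ?thesis
      using that X_commute[of i j k] by (auto simp: act_zero_right act_closed)
  qed (use swap that in blast)
  show ?thesis
  proof (cases "p = j")
    case True
    then show ?thesis using next_edge assms by blast
  next
    case False
    then show ?thesis using next_edge[of j p q] next_edge[of i j p] assms by blast
  qed
qed

text \<open>All generators, hence all elements, act as \<open>0\<close>. Every line is then a
  submodule, so irreducibility forces dimension 1.\<close>

lemma trivial_if_X_vanishes:
  assumes irreducible_module "i \<noteq> j" "\<forall>v\<in>M. X i j v = 0"
  shows trivial_module
proof -
  have zero: "\<forall>v\<in>M. act u v = 0" for u
  proof (induction u rule: tetra_induct)
    case (gen p q)
    then show ?case using X_vanishes_transfer assms by blast
  qed (simp_all add: act_simps act_bracket)
  obtain v where v: "v \<in> M" "v \<noteq> 0"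
    using assms(1) V.subspace_0[OF subspace_carrier] unfolding irreducible_module_def by blast
  have "submodule (V.span {v})"
    unfolding submodule_def
    using V.span_minimal[of "{v}" M] subspace_carrier v zero V.span_zero by auto
  moreover have "V.span {v} \<noteq> {0}"
    using v V.span_base[of v "{v}"] by auto
  ultimately have "V.span {v} = M"
    using assms(1) unfolding irreducible_module_def by blast
  moreover have "V.dim (V.span {v}) = 1"
    using V.dim_span_eq_card_independent[of "{v}"] v by simp
  ultimately show ?thesis
    unfolding trivial_module_def using zero by simp
qed

section \<open>Moving a linear relation to a neighbouring vertex\<close>

text \<open>The claim is that an operator vanishes. A nonzero one would be a highest weight vector
  in the endomorphism module, of a weight that finite dimension rules out.\<close>

lemma dependency_transfer:
  assumes UNIV: "M = UNIV" and "finite_dim" and ijkl: "distinct [i, j, k, l]"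
    and pq: "p + q = 1" and q: "q \<noteq> 0"
    and dep: "\<And>v. X i l v = sV p (X i j v) + sV q (X i k v)"
  shows "sV q (X j l v) = sV p (X i j v) + X j k v"
proof -
  obtain B where B: "finite B" "V.span B = UNIV"
    using assms(1,2) unfolding finite_dim_def by blast
  obtain C where C: "finite C" "{T. Vector_Spaces.linear sV sV T}
      \<subseteq> module.span (\<lambda>c (T :: 'v \<Rightarrow> 'v) v. sV c (T v)) C"
    using V.linear_maps_finitely_spanned[OF B] by blast
  obtain \<phi> :: "'f sl2 \<Rightarrow> 'f tetra"
    where \<phi>: "lie_hom sl2_scale sl2_bracket tetra_scale tetra_bracket \<phi>"
    and \<phi>_x: "\<phi> sl2_x = tetra_x i k" and \<phi>_z: "\<phi> sl2_z = tetra_x j i"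
    using equitable_triple_hom[OF lie_algebra_tetra,
        of "tetra_x i k" "tetra_x k j" "tetra_x j i"] ijkl by (auto simp: tetra_relation_2)
  interpret S: sl2_module sV M "\<lambda>u. act (\<phi> u)"
    by (intro sl2_module.intro lie_module_pullback \<phi>)
  interpret E: sl2_module "\<lambda>c (T :: 'v \<Rightarrow> 'v) v. sV c (T v)" "{T. Vector_Spaces.linear sV sV T}"
      "\<lambda>u T v. act (\<phi> u) (T v) - T (act (\<phi> u) v)"
    by (intro sl2_module.intro S.lie_module_End UNIV)
  note [simp] = act_simps[unfolded UNIV, simplified]
  note comm = X_commute[unfolded UNIV, simplified] X_commute_source[unfolded UNIV, simplified]
    X_commute_target[unfolded UNIV, simplified]
  have p: "p = 1 - q" using pq by (simp add: algebra_simps)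
  define \<delta> where "\<delta> v = sV q (X j l v) - sV p (X i j v) - X j k v" for v
  have \<delta>_lin: "\<delta> \<in> {T. Vector_Spaces.linear sV sV T}"
    by (simp add: \<delta>_def Vector_Spaces.linear_iff V.vector_space_axioms algebra_simps)
  have \<delta>_simps: "\<delta> (v + w) = \<delta> v + \<delta> w" "\<delta> (sV c v) = sV c (\<delta> v)" "\<delta> (- v) = - \<delta> v" for c v w
    by (simp_all add: \<delta>_def algebra_simps)
  have h: "act (\<phi> sl2_h) v = - X i j v" for v
    using \<phi>_z X_swap[of i j v] ijkl UNIV by (auto simp: sl2_z_def)
  have "sl2_x = sl2_scale 2 sl2_e - (sl2_h :: 'f sl2)"
    by (simp add: sl2_x_def)
  then have e: "sV 2 (act (\<phi> sl2_e) v) = X i k v - X i j v" for v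
    using S.act_diff_left[of v "sl2_scale 2 sl2_e" sl2_h] S.act_scale_left[of v 2 sl2_e] \<phi>_x h[of v] UNIV
    by simp
  \<comment> \<open>\<open>K\<close> is twice the action of e, since
    \<open>2 e = sl2_x + sl2_z\<close> maps to \<open>tetra_x i k + tetra_x j i\<close>.\<close>
  define K where "K v = X i k v - X i j v" for v
  have e: "act (\<phi> sl2_e) v = sV (1 / 2) (K v)" for v
    using e[of v] V.scale_cancel_left[of 2 "act (\<phi> sl2_e) v" "sV (1 / 2) (K v)"] by (simp add: K_def)
  \<comment> \<open>The edges \<open>i k\<close> and \<open>j l\<close> are opposite, so relation
    (ii) does not give the commutator of \<open>K\<close> with \<open>X j l\<close>. The dependency
    turns \<open>q K\<close> into \<open>X i l - X i j\<close>, and both of these edges meet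
    \<open>j l\<close>.\<close>
  have qK: "X i l v - X i j v = sV q (K v)" for v
  proof -
    have "sV q (K v) = X i l v - sV (p + q) (X i j v)"
      by (simp add: dep K_def algebra_simps)
    then show ?thesis by (simp add: pq)
  qed
  have K_lin: "K (v - w) = K v - K w" "K (sV c v) = sV c (K v)" for c v w
    by (simp_all add: K_def algebra_simps)
  have K_ij: "K (X i j v) = X i j (K v) + sV 2 (K v)" for v
    using comm(2)[of i k j v] ijkl by (auto simp: K_def algebra_simps)
  have K_jk: "K (X j k v) = X j k (K v) - sV 2 (X i k v) - sV 2 (X i j v)" for v
    using comm(1)[of i j k v] comm(3)[of i j k v] ijkl by (simp add: K_def algebra_simps)
  have K_jl: "sV q (K (X j l v)) = X j l (sV q (K v)) - sV 2 (X i l v) - sV 2 (X i j v)" for v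
    unfolding qK[symmetric]
    using comm(1)[of i j l v] comm(3)[of i j l v] ijkl by (simp add: algebra_simps)
  have "K (\<delta> v) = \<delta> (K v)" for v
  proof -
    \<comment> \<open>The right side is \<open>2 (X i k - X i l) - 2 p K\<close>, and the dependency
      says \<open>X i k - X i l = p K\<close>.\<close>
    have "K (\<delta> v) - \<delta> (K v) = sV (p + q) (sV 2 (X i k v) + sV 2 (X i j v))
        - sV 2 (X i l v) - sV 2 (X i j v) - sV (2 * p) (K v)"
      unfolding \<delta>_def K_lin K_ij K_jk K_jl pq by (simp add: algebra_simps)
    moreover have "sV (p + q) (sV 2 (X i k v) + sV 2 (X i j v))
        - sV 2 (X i l v) - sV 2 (X i j v) - sV (2 * p) (K v) = 0"
      by (simp add: K_def dep p algebra_simps)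
    ultimately show ?thesis by simp
  qed
  then have e_weight: "act (\<phi> sl2_e) (\<delta> v) - \<delta> (act (\<phi> sl2_e) v) = 0" for v
    by (simp add: e \<delta>_simps)
  have h_weight: "act (\<phi> sl2_h) (\<delta> v) - \<delta> (act (\<phi> sl2_h) v) = sV (- 2) (\<delta> v)" for v
    using comm(1)[of i j l v] comm(1)[of i j k v] ijkl
    by (simp add: h \<delta>_simps) (simp add: \<delta>_def p algebra_simps)
  have "\<delta> = 0"
  proof (rule ccontr)
    assume "\<delta> \<noteq> 0"
    then obtain d where "- 2 = (of_nat d :: 'f)"
      using E.highest_weight[OF \<delta>_lin _ _ C, of "- 2"] e_weight h_weight
      by (auto simp: fun_eq_iff)
    then have "of_nat (d + 2) = (0 :: 'f)" by simp
    then show False by (simp only: of_nat_eq_0_iff)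
  qed
  then show ?thesis by (simp add: \<delta>_def fun_eq_iff algebra_simps)
qed

end

section \<open>Linear relations at a vertex\<close>

context tetra_module
begin

text \<open>For a nontrivial irreducible module, \<open>dependent_at_if_dependent\<close> brings
  every nonzero relation into this form, which is symmetric in \<open>j\<close>, \<open>k\<close>,
  \<open>l\<close> and suited to transfer between vertices.\<close>

definition dependent_at :: "4 \<Rightarrow> 4 \<Rightarrow> 4 \<Rightarrow> 4 \<Rightarrow> bool" where
  "dependent_at i j k l \<longleftrightarrow> (\<exists>a b c. a \<noteq> 0 \<and> b \<noteq> 0 \<and> c \<noteq> 0 \<and> a + b + c = 0 \<and>
     (\<forall>v\<in>M. sV a (X i j v) + sV b (X i k v) + sV c (X i l v) = 0))"

lemma dependent_at_swap:
  assumes "dependent_at i j k l"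
  shows "dependent_at i k j l" "dependent_at i j l k"
proof -
  obtain a b c where abc: "a \<noteq> 0" "b \<noteq> 0" "c \<noteq> 0" "a + b + c = 0"
    and dep: "\<forall>v\<in>M. sV a (X i j v) + sV b (X i k v) + sV c (X i l v) = 0"
    using assms unfolding dependent_at_def by blast
  show "dependent_at i k j l"
    unfolding dependent_at_def using abc dep
    by (intro exI[of _ b] exI[of _ a] exI[of _ c]) (simp add: ac_simps)
  show "dependent_at i j l k"
    unfolding dependent_at_def using abc dep
    by (intro exI[of _ a] exI[of _ c] exI[of _ b]) (simp add: ac_simps)
qed

text \<open>If the two agreed, their commutators with \<open>X j k\<close>, namely
  \<open>2 X i j + 2 X j k\<close> and \<open>2 X j k - 2 X i k\<close>, would agree too. This gives
  \<open>4 X i j = 0\<close>, and the module would be trivial.\<close>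

lemma X_distinct:
  assumes "irreducible_module" "\<not> trivial_module" "distinct [i, j, k]"
  shows "\<exists>v\<in>M. X i j v \<noteq> X i k v"
proof (rule ccontr)
  assume "\<not> ?thesis"
  then have eq: "X i j v = X i k v" if "v \<in> M" for v
    using that by blast
  have "X i j v = 0" if v: "v \<in> M" for v
  proof -
    have "X i j (X j k v) = X j k (X i j v) + sV 2 (X i j v) + sV 2 (X j k v)"
      by (rule X_commute[OF assms(3) v])
    moreover have "X i k (X j k v) = X j k (X i k v) + sV 2 (X j k v) - sV 2 (X i k v)"
      by (rule X_commute_target[OF assms(3) v])
    ultimately have "sV 2 (X i j v) + sV 2 (X i j v) = 0"
      using eq v by (simp add: act_closed algebra_simps)
    then have "sV (2 + 2) (X i j v) = 0"
      by (simp only: V.scale_left_distrib)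
    then show ?thesis by simp
  qed
  then show False
    using trivial_if_X_vanishes[of i j] assms by auto
qed

lemma dependent_at_if_dependent:
  assumes "irreducible_module" "\<not> trivial_module" and ijkl: "distinct [i, j, k, l]"
    and nz: "\<not> (a = 0 \<and> b = 0 \<and> c = 0)"
    and dep: "\<forall>v\<in>M. sV a (X i j v) + sV b (X i k v) + sV c (X i l v) = 0"
  shows "dependent_at i j k l"
proof -
  obtain w where w: "w \<in> M" "X i j w \<noteq> 0"
    using trivial_if_X_vanishes[of i j] assms(1,2) ijkl by auto
  have "sV (a + b + c) (X i j w) = 0"
  proof -
    let ?s = "\<lambda>v. sV a (X i j v) + sV b (X i k v) + sV c (X i l v)"
    \<comment> \<open>The commutator of \<open>X i j\<close> with the combination is
      \<open>2 (a + b + c) X i j\<close> minus twice the combination, which is zero.\<close>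
    have "X i j (?s w) - ?s (X i j w) =
        sV 2 (sV (a + b + c) (X i j w) - ?s w)"
      using X_commute_source[of i j k w] X_commute_source[of i j l w] ijkl w(1)
        V.subspace_add[OF subspace_carrier] V.subspace_scale[OF subspace_carrier]
      by (simp add: act_simps) (simp add: algebra_simps)
    then have "sV 2 (sV (a + b + c) (X i j w)) = 0"
      using dep w(1) by (simp add: act_zero_right act_closed del: V.scale_scale)
    then show ?thesis
      unfolding V.scale_eq_0_iff[of 2] by simp
  qed
  then have sum: "a + b + c = 0" using w by simp
  \<comment> \<open>With sum \<open>0\<close>, one vanishing coefficient makes the other two
    opposite, so two generators at \<open>i\<close> would act equally.\<close>
  have two: False if "p \<noteq> 0" "distinct [i, m, n]"
    "\<forall>v\<in>M. sV p (X i m v) + sV (- p) (X i n v) = 0" for p m n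
    using X_distinct[OF assms(1,2) that(2)] that(1,3) by auto
  have "a \<noteq> 0"
  proof
    assume "a = 0"
    moreover from this have "c = - b" using sum by (simp add: eq_neg_iff_add_eq_0 add.commute)
    ultimately show False
      using two[of b k l] dep nz ijkl by simp
  qed
  moreover have "b \<noteq> 0"
  proof
    assume "b = 0"
    moreover from this have "c = - a" using sum by (simp add: eq_neg_iff_add_eq_0 add.commute)
    ultimately show False
      using two[of a j l] dep nz ijkl by simp
  qed
  moreover have "c \<noteq> 0"
  proof
    assume "c = 0"
    moreover from this have "b = - a" using sum by (simp add: eq_neg_iff_add_eq_0 add.commute)
    ultimately show False
      using two[of a j k] dep nz ijkl by simp
  qed
  ultimately show ?thesis
    unfolding dependent_at_def using sum dep by blast
qed

lemma dependent_at_explicit: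
  assumes "dependent_at i j k l"
  shows "\<exists>p. p \<noteq> 0 \<and> p \<noteq> 1 \<and> (\<forall>v\<in>M. X i l v = sV p (X i j v) + sV (1 - p) (X i k v))"
proof -
  obtain a b c where abc: "a \<noteq> 0" "b \<noteq> 0" "c \<noteq> 0" "a + b + c = 0"
    and dep: "\<forall>v\<in>M. sV a (X i j v) + sV b (X i k v) + sV c (X i l v) = 0"
    using assms unfolding dependent_at_def by blast
  have b: "b = - a - c"
    using abc(4) by (simp add: algebra_simps eq_neg_iff_add_eq_0)
  then have q: "1 - (- a / c) = - b / c" unfolding b using abc(3) by (simp add: field_simps)
  have "X i l v = sV (- a / c) (X i j v) + sV (1 - (- a / c)) (X i k v)" if "v \<in> M" for v
  proof -
    have "sV c (X i l v - (sV (- a / c) (X i j v) + sV (- b / c) (X i k v))) =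
        sV a (X i j v) + sV b (X i k v) + sV c (X i l v)"
      using abc(3) by (simp add: algebra_simps)
    also have "\<dots> = 0" using dep that by blast
    finally show ?thesis unfolding q using abc(3) by simp
  qed
  \<comment> \<open>\<open>- a / c = 1\<close> would force \<open>b = 0\<close>.\<close>
  moreover have "- a / c \<noteq> 0" "- a / c \<noteq> 1"
    using abc(1-3) b by (auto simp: field_simps)
  ultimately show ?thesis by blast
qed

lemma dependent_at_transfer:
  assumes "M = UNIV" "finite_dim" "distinct [i, j, k, l]" "dependent_at i j k l"
  shows "dependent_at j i k l"
proof -
  obtain p where p: "p \<noteq> 0" "p \<noteq> 1" "\<forall>v\<in>M. X i l v = sV p (X i j v) + sV (1 - p) (X i k v)"
    using dependent_at_explicit[OF assms(4)] by blast
  then have "sV (1 - p) (X j l v) = sV p (X i j v) + X j k v" for v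
    using dependency_transfer[OF assms(1-3), of p "1 - p"] assms(1) by simp
  moreover have "X j i v = - X i j v" for v
    using X_swap[of i j v] assms(1,3) by simp
  \<comment> \<open>Reversing the edge \<open>i j\<close> gives all three edges the source
    \<open>j\<close>; the coefficients \<open>p\<close>, \<open>- 1\<close>, \<open>1 - p\<close>
    again sum to \<open>0\<close>.\<close>
  ultimately have "\<forall>v\<in>M. sV p (X j i v) + sV (- 1) (X j k v) + sV (1 - p) (X j l v) = 0"
    by simp
  then show ?thesis
    unfolding dependent_at_def using p(1,2)
    by (intro exI[of _ p] exI[of _ "- 1"] exI[of _ "1 - p"]) simp
qed

lemma dependent_at_0123:
  assumes "M = UNIV" "finite_dim" "distinct [i, j, k, l]" "dependent_at i j k l"
  shows "dependent_at 0 1 2 3"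
proof -
  define D where "D i j k l \<longleftrightarrow> distinct [i, j, k, l] \<and> dependent_at i j k l" for i j k l
  \<comment> \<open>Transfer exchanges the first two vertices and symmetry permutes the last three.
    These adjacent transpositions generate all orderings of the four vertices.\<close>
  have swaps: "D j i k l" "D i k j l" "D i j l k" if "D i j k l" for i j k l
  proof -
    from that have ijkl: "distinct [i, j, k, l]" "dependent_at i j k l"
      by (simp_all add: D_def)
    show "D j i k l"
      using dependent_at_transfer[OF assms(1,2) ijkl] ijkl(1) by (auto simp: D_def)
    show "D i k j l" "D i j l k"
      using dependent_at_swap[OF ijkl(2)] ijkl(1) by (auto simp: D_def)
  qed
  have "D i j k l" using assms(3,4) by (simp add: D_def)
  moreover have "0 \<in> {i, j, k, l}"
    using tetra_index_cases[of i] tetra_index_cases[of j] tetra_index_cases[of k]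
      tetra_index_cases[of l] assms(3) by auto
  ultimately have "\<exists>j k l. D 0 j k l"
    using swaps by blast
  then obtain j k l where D: "D 0 j k l" by blast
  then have "1 \<in> {j, k, l}"
    using tetra_index_cases[of j] tetra_index_cases[of k] tetra_index_cases[of l]
    by (auto simp: D_def)
  then have "\<exists>k l. D 0 1 k l"
    using swaps(2,3) D by blast
  then obtain k l where D: "D 0 1 k l" by blast
  then have "k = 2 \<and> l = 3 \<or> k = 3 \<and> l = 2"
    using tetra_index_cases[of k] tetra_index_cases[of l] by (auto simp: D_def)
  then have "D 0 1 2 3" using D swaps(3) by blast
  then show ?thesis by (simp add: D_def)
qed

section \<open>Factoring the action through \<open>EV a\<close>\<close>

text \<open>The three edges at \<open>0\<close> are solved for in terms of the triangle
  \<open>1, 2, 3\<close>, and the solution is the formula for \<open>EV a\<close>. The clause on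
  \<open>sl2_z\<close> serves later to exclude \<open>d = 0\<close>.\<close>

lemma act_factors_through_EV:
  assumes "M = UNIV" "finite_dim" "dependent_at 0 1 2 3"
  shows "\<exists>\<phi> a. lie_hom sl2_scale sl2_bracket tetra_scale tetra_bracket \<phi> \<and> a \<noteq> 0 \<and> a \<noteq> 1 \<and>
    \<phi> sl2_z = tetra_x 3 1 \<and> (\<forall>u v. act u v = act (\<phi> (EV a u)) v)"
proof -
  obtain a where a: "a \<noteq> 0" "a \<noteq> 1" and x03: "\<And>v. X 0 3 v = sV a (X 0 1 v) + sV (1 - a) (X 0 2 v)"
    using dependent_at_explicit[OF assms(3)] assms(1) by auto
  \<comment> \<open>Transfer to the vertices 1 and 2; at 2 the roles of \<open>a\<close> and
    \<open>1 - a\<close> are exchanged. These equations determine \<open>X 0 1\<close> and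
    \<open>X 0 2\<close>.\<close>
  have x13: "sV (1 - a) (X 1 3 v) = sV a (X 0 1 v) + X 1 2 v" for v
    using dependency_transfer[OF assms(1,2), of 0 1 2 3 a "1 - a"] a x03 by simp
  have x23: "sV a (X 2 3 v) = sV (1 - a) (X 0 2 v) + X 2 1 v" for v
    using dependency_transfer[OF assms(1,2), of 0 2 1 3 "1 - a" a] a x03 by (simp add: add.commute)
  obtain \<phi> :: "'f sl2 \<Rightarrow> 'f tetra"
    where \<phi>: "lie_hom sl2_scale sl2_bracket tetra_scale tetra_bracket \<phi>"
    and xyz: "\<phi> sl2_x = tetra_x 1 2" "\<phi> sl2_y = tetra_x 2 3" "\<phi> sl2_z = tetra_x 3 1"
    using equitable_triple_hom[OF lie_algebra_tetra,
        of "tetra_x 1 2" "tetra_x 2 3" "tetra_x 3 1"] by (auto simp: tetra_relation_2)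
  interpret E: lie_hom tetra_scale tetra_bracket sl2_scale sl2_bracket "EV a"
    using is_EV_EV[OF a] by (simp add: is_EV_def)
  interpret P: lie_hom sl2_scale sl2_bracket tetra_scale tetra_bracket \<phi> by fact
  note [simp] = act_simps[unfolded assms(1), simplified]
  note EV = is_EV_EV[OF a, unfolded is_EV_def]
  have swap: "X j i v = - X i j v" if "i \<noteq> j" for i j v
    using X_swap[OF that, of v] assms(1) by simp
  have cancel: "v = w" if "c \<noteq> 0" "sV c v = sV c w" for c v w
    using that by simp
  have x13': "sV (a - 1) (X 3 1 v) = sV a (X 0 1 v) + X 1 2 v" for v
    using x13[of v] by (simp add: swap[of 1 3] algebra_simps)
  have e01: "X 0 1 v = act (\<phi> (EV a (tetra_x 0 1))) v" for v
  proof (rule cancel[OF a(1)])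
    \<comment> \<open>Scaling by \<open>a\<close> clears the inverses in
      \<open>EV a\<close>.\<close>
    have "sV a (act (\<phi> (EV a (tetra_x 0 1))) v) = sV (a - 1) (X 3 1 v) - X 1 2 v"
      using a by (simp add: EV P.add P.diff P.scale xyz algebra_simps)
    also have "\<dots> = sV a (X 0 1 v)"
      by (simp add: x13')
    finally show "sV a (X 0 1 v) = sV a (act (\<phi> (EV a (tetra_x 0 1))) v)" ..
  qed
  have e02: "X 0 2 v = act (\<phi> (EV a (tetra_x 0 2))) v" for v
  proof (rule cancel)
    show "1 - a \<noteq> 0" using a by simp
    have "sV (1 - a) (act (\<phi> (EV a (tetra_x 0 2))) v) = X 1 2 v + sV a (X 2 3 v)"
      using a by (simp add: EV P.add P.diff P.scale xyz V.scale_right_distrib)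
    also have "\<dots> = sV (1 - a) (X 0 2 v)"
      by (simp add: x23 swap[of 1 2])
    finally show "sV (1 - a) (X 0 2 v) = sV (1 - a) (act (\<phi> (EV a (tetra_x 0 2))) v)" ..
  qed
  \<comment> \<open>Substituting the two solved edges into \<open>x03\<close>, the
    \<open>X 1 2\<close> terms cancel.\<close>
  have e03: "X 0 3 v = act (\<phi> (EV a (tetra_x 0 3))) v" for v
    by (simp add: EV P.add P.diff P.scale xyz x23 x13' x03 swap[of 1 2])
  have e: "X 1 2 v = act (\<phi> (EV a (tetra_x 1 2))) v" "X 2 3 v = act (\<phi> (EV a (tetra_x 2 3))) v"
    "X 3 1 v = act (\<phi> (EV a (tetra_x 3 1))) v" for v
    by (simp_all add: EV xyz)
  have e_swap: "X j i v = act (\<phi> (EV a (tetra_x j i))) v"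
    if "\<And>v. X i j v = act (\<phi> (EV a (tetra_x i j))) v" "i \<noteq> j" for i j v
  proof -
    have "tetra_x j i = - (tetra_x i j :: 'f tetra)"
      using tetra_relation_1[of j i] that(2) by (simp add: eq_neg_iff_add_eq_0)
    then show ?thesis by (simp add: E.neg P.neg that(1)[symmetric])
  qed
  note edges = e01 e02 e03 e
  have "act u v = act (\<phi> (EV a u)) v" for u v
  proof (induction u arbitrary: v rule: tetra_induct)
    case (gen i j)
    then show ?case
      using tetra_index_cases[of i] tetra_index_cases[of j]
      by (elim disjE) (simp_all add: edges edges[THEN e_swap])
  next
    case (bracket u w)
    then show ?case
      by (simp add: E.hom_bracket P.hom_bracket act_bracket assms(1))
  qed (simp_all add: E.add E.scale P.add P.scale)
  then show ?thesis
    using \<phi> a xyz by blast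
qed

end

section \<open>Evaluation modules are the modules with dependent generators at a vertex\<close>

theorem proposition6p3:
  fixes scale :: "'f::{alg_closed_field, field_char_0} \<Rightarrow> 'v::ab_group_add \<Rightarrow> 'v"
    and act :: "'f tetra \<Rightarrow> 'v \<Rightarrow> 'v"
  assumes "lie_module tetra_scale tetra_bracket scale UNIV act"
    and "lie_module.finite_dim scale (UNIV :: 'v set)"
    and "lie_module.irreducible_module scale UNIV act"
    and "\<not> lie_module.trivial_module scale UNIV act"
  shows "(\<exists>d a. d \<ge> 1 \<and> a \<noteq> 0 \<and> a \<noteq> 1 \<and>
            isomorphic_modules scale UNIV act smult (Vd d) (EV_act d a)) \<longleftrightarrow>
         (\<exists>i j k l. distinct [i, j, k, l] \<and>
            (\<exists>\<alpha> \<beta> \<gamma>. \<not> (\<alpha> = 0 \<and> \<beta> = 0 \<and> \<gamma> = 0) \<and>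
               (\<forall>v. scale \<alpha> (act (tetra_x i j) v) + scale \<beta> (act (tetra_x i k) v)
                    + scale \<gamma> (act (tetra_x i l) v) = 0)))"
    (is "?L \<longleftrightarrow> ?R")
proof
  interpret tetra_module scale UNIV act by (intro tetra_module.intro assms)
  assume ?L
  then obtain d a \<phi> where a: "a \<noteq> 0" "a \<noteq> 1"
    and "module_iso scale UNIV act smult (Vd d) (EV_act d a) \<phi>"
    unfolding isomorphic_modules_def by blast
  then have bij: "bij_betw \<phi> UNIV (Vd d)" and \<phi>: "\<And>v w. \<phi> (v + w) = \<phi> v + \<phi> w"
    "\<And>c v. \<phi> (scale c v) = smult c (\<phi> v)" "\<And>u v. \<phi> (act u v) = EV_act d a u (\<phi> v)"
    unfolding module_iso_def by auto
  interpret D: lie_module tetra_scale tetra_bracket smult "Vd d" "EV_act d a"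
    by (rule lie_module_EV_act[OF a])
  \<comment> \<open>\<open>EV a\<close> sends \<open>a x01\<close> to \<open>(a - 1) z - x\<close>
    and \<open>(1 - a) x02\<close> to \<open>x + a y\<close>; their sum is the image of
    \<open>x03\<close>. Injectivity of \<open>\<phi>\<close> carries the relation back.\<close>
  have "scale a (X 0 1 v) + scale (1 - a) (X 0 2 v) + scale (- 1) (X 0 3 v) = 0" for v
  proof -
    have v: "\<phi> v \<in> Vd d" using bij by (auto simp: bij_betw_def)
    let ?u = "tetra_scale a (tetra_x 0 1) + tetra_scale (1 - a) (tetra_x 0 2)
      + tetra_scale (- 1) (tetra_x 0 3)"
    interpret E: lie_hom tetra_scale tetra_bracket sl2_scale sl2_bracket "EV a"
      using is_EV_EV[OF a] by (simp add: is_EV_def)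
    have "EV a ?u = 0"
      using is_EV_EV[OF a] unfolding E.add E.scale is_EV_def using a
      by (simp add: sl2_basis_simps zero_prod_def field_simps)
    then have "\<phi> (act ?u v) = 0"
      by (simp add: \<phi>(3) EV_act_def zero_prod_def)
    moreover have "\<phi> 0 = 0" using \<phi>(2)[of 0 0] by simp
    ultimately have "act ?u v = 0"
      using bij by (metis bij_betw_def UNIV_I inj_on_def)
    then show ?thesis by (simp add: act_simps)
  qed
  moreover have "distinct [0, 1, 2, 3 :: 4]" by simp
  ultimately show ?R using a(1) by blast
next
  interpret tetra_module scale UNIV act by (intro tetra_module.intro assms)
  assume ?R
  then obtain i j k l \<alpha> \<beta> \<gamma> where "distinct [i, j, k, l]" "\<not> (\<alpha> = 0 \<and> \<beta> = 0 \<and> \<gamma> = 0)"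
    "\<forall>v\<in>UNIV. scale \<alpha> (X i j v) + scale \<beta> (X i k v) + scale \<gamma> (X i l v) = 0"
    by blast
  then have "dependent_at 0 1 2 3"
    using dependent_at_if_dependent[OF assms(3,4)] dependent_at_0123[OF refl assms(2)] by blast
  then obtain \<phi> a where \<phi>: "lie_hom sl2_scale sl2_bracket tetra_scale tetra_bracket \<phi>"
    and a: "a \<noteq> 0" "a \<noteq> 1" and z: "\<phi> sl2_z = tetra_x 3 1"
    and factor: "\<And>u v. act u v = act (\<phi> (EV a u)) v"
    using act_factors_through_EV[OF refl assms(2)] by blast
  interpret S: lie_module sl2_scale sl2_bracket scale UNIV "\<lambda>x. act (\<phi> x)"
    by (rule lie_module_pullback[OF \<phi>])
  \<comment> \<open>By \<open>factor\<close>, each \<open>act u\<close> is the action of an element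
    of sl2, so irreducibility passes to the sl2-module.\<close>
  have "submodule N" if "S.submodule N" for N
    using that factor unfolding submodule_def S.submodule_def by metis
  then have "S.irreducible_module"
    using assms(3) unfolding irreducible_module_def S.irreducible_module_def by blast
  then obtain d \<psi> where \<psi>: "module_iso scale UNIV (\<lambda>x. act (\<phi> x)) smult (Vd d) (sl2_act d) \<psi>"
    using irreducible_sl2_module_isomorphic_Vd[OF S.lie_module_axioms assms(2)]
    unfolding isomorphic_modules_def by blast
  \<comment> \<open>For \<open>d = 0\<close> the module consists of constants, which h kills. Then
    \<open>X 3 1\<close> would vanish and the module would be trivial.\<close>
  have "d \<noteq> 0"
  proof
    assume [simp]: "d = 0"
    have "X 3 1 v = 0" for v
    proof -
      have "degree (\<psi> v) = 0"
        using \<psi> by (auto simp: module_iso_def bij_betw_def Vd_def)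
      then obtain c where "\<psi> v = [:c:]" by (metis degree_eq_zeroE)
      then have "\<psi> (X 3 1 v) = 0"
        using \<psi> by (simp add: module_iso_def sl2_z_def sl2_h_def flip: z)
      moreover have "\<psi> (scale 0 0) = smult 0 (\<psi> 0)"
        using \<psi> unfolding module_iso_def by blast
      ultimately show ?thesis
        using \<psi> by (simp add: module_iso_def bij_betw_def inj_on_def)
    qed
    then show False
      using trivial_if_X_vanishes[OF assms(3), of 3 1] assms(4) by simp
  qed
  \<comment> \<open>The same map intertwines both actions, since each factors through
    \<open>EV a\<close>.\<close>
  moreover have "module_iso scale UNIV act smult (Vd d) (EV_act d a) \<psi>"
    using \<psi> factor unfolding module_iso_def EV_act_def by metis
  ultimately show ?L
    using a unfolding isomorphic_modules_def by (metis One_nat_def Suc_leI neq0_conv)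
qed

end
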